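(* Consider the game with shared equality constraint set $X=X^e$ described in the context, let Assumptions 1 and 2 (as stated in the context) hold, and let the graph $\mathcal G$ be undirected and connected. Let $\rho\in[1,2)$, let $\{\mu_k\}$ be a nonnegative sequence with $\sum_{k=1}^\infty \mu_k<\infty$, and let the parameters $R_i\in\mathbf R^{n_i\times n_i}$, $H_i\in\mathbf R^{m\times m}$ ($i\in\mathcal N$) and $W_l\in\mathbf R^{m\times m}$ ($l=1,\dots,M$) be symmetric positive definite and such that the matrices $R-\Lambda^T H\Lambda$ and $W^{-1}-\bar V^T H\bar V$ are positive definite. Then any sequence $col(\mathbf x_k,\mathbf Z_k,\bar\lambda_k)$ generated by Algorithm 1 (described in the context) converges to some $col(\mathbf x^*,\mathbf Z^*,\bar\lambda^* )\in zer\,\mathfrak M^e$. Furthermore, $\mathbf x^*$ is a variational GNE of the game with $X=X^e$, and $\bar\lambda^*=\mathbf 1_N\otimes\lambda^*$ for some $\lambda^*\in\mathbf R^m$.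
   Context: Notation. $col(\cdot)$ is the stacked column vector, $diag\{\cdot\}$ the block diagonal matrix, $\|x\|_G^2=x^TGx$ for symmetric $G$, $\|\cdot\|$ the Euclidean norm, $\otimes$ the Kronecker product, $\mathbf 1_N$ the all-ones vector. For a closed convex set $\Omega$, $N_\Omega(x)=\{v: \langle v,y-x\rangle\le 0\ \forall y\in\Omega\}$ for $x\in\Omega$ (empty otherwise). For a set-valued operator $\mathfrak A$, $zer\,\mathfrak A=\{x:\mathbf 0\in\mathfrak A x\}$. "l.s.c. function" means lower semicontinuous convex function; its subdifferential at $x\in dom f$ is $\partial f(x)=\{g: f(y)\ge f(x)+\langle g,y-x\rangle\ \forall y\in dom f\}$. Game. Players $\mathcal N=\{1,\dots,N\}$; player $i$ chooses $x_i\in\Omega_i\subset\mathbf R^{n_i}$; $n=\sum_i n_i$, $\mathbf x=col(x_1,\dots,x_N)\in\mathbf R^n$, $\mathbf x_{-i}$ is the profile of all players except $i$, $\bar\Omega=\prod_{i=1}^N\Omega_i$. Player $i$ has objective $f_i(x_i,\mathbf x_{-i}):\bar\Omega\to\mathbf R$, $A_i\in\mathbf R^{m\times n_i}$, $b_i\in\mathbf R^m$. The shared set is $X=X^e:=\bar\Omega\cap\{\mathbf x:\sum_{i=1}^N A_ix_i=\sum_{i=1}^N b_i\}$, and $X_i(\mathbf x_{-i})=\{x_i\in\Omega_i:(x_i,\mathbf x_{-i})\in X\}$. Player $i$ minimizes $f_i(x_i,\mathbf x_{-i})$ over $x_i\in X_i(\mathbf x_{-i})$. A generalized Nash equilibrium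 (GNE) is $\mathbf x^*$ with $x_i^*\in\arg\min\{f_i(x_i,\mathbf x_{-i}^* ):x_i\in X_i(\mathbf x_{-i}^* )\}$ for all $i$. With $\partial_i f_i(x_i,\mathbf x_{-i})$ the subdifferential in $x_i$, the pseudo-subdifferential is $\partial F(\mathbf x)=\prod_{i=1}^N\partial_i f_i(x_i,\mathbf x_{-i})$. The generalized variational inequality (GVI) is: find $\mathbf x^*\in X$ for which there is $l^*\in\partial F(\mathbf x^* )$ with $\langle l^*,\mathbf x-\mathbf x^*\rangle\ge0$ for all $\mathbf x\in X$. Any solution of the GVI is a GNE; such a solution is called a variational GNE. Assumption 1. For each $i$, $f_i(\cdot,\mathbf x_{-i})$ is a proper l.s.c. (convex) function for every fixed $\mathbf x_{-i}$; $\partial F$ is maximally monotone; each $\Omega_i$ is closed convex with nonempty interior; $X^e$ has nonempty relative interior; $X_i(\mathbf x_{-i})$ has nonempty relative interior for every $\mathbf x_{-i}\in\prod_{j\ne i}\Omega_j$. Assumption 2. The GVI has at least one solution, i.e. the game has at least one variational GNE. Standing fact used by the paper (Lagrangian duality for the GVI): $\mathbf x^*$ solves the GVI with $X=X^e$ if and only if there is $\lambda^*\in\mathbf R^m$ with $\mathbf 0\in\partial_i f_i(x_i^*,\mathbf x_{-i}^* )+A_i^T\lambda^*+N_{\Omega_i}(x_i^* )$ for all $i$ and $\sum_iA_ix_i^*=\sum_ib_i$. Graph. $\mathcal G=(\mathcal N,\mathcal E)$ is a connected undirected graph with $M$ edges $e_1,\dots,e_M$, each given an arbitrary orientation $i\to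 j$. $\mathcal E_i^{in}$ (resp. $\mathcal E_i^{out}$) is the set of edges with target (resp. start) $i$, $\mathcal E_i=\mathcal E_i^{in}\cup\mathcal E_i^{out}$. The incidence matrix $V\in\mathbf R^{N\times M}$ has $V_{il}=1$ if $e_l\in\mathcal E_i^{in}$, $-1$ if $e_l\in\mathcal E_i^{out}$, $0$ otherwise. Compact notation. $\lambda_i\in\mathbf R^m$ is the local multiplier of player $i$, $z_l\in\mathbf R^m$ the variable of edge $e_l$; $\bar\lambda=col(\lambda_1,\dots,\lambda_N)$, $\mathbf Z=col(z_1,\dots,z_M)$, $R=diag\{R_1,\dots,R_N\}$, $H=diag\{H_1,\dots,H_N\}$, $W=diag\{W_1,\dots,W_M\}$, $\bar V=V\otimes I_m$, $\Lambda=diag\{A_1,\dots,A_N\}$, $\bar b=col(b_1,\dots,b_N)$. Algorithm 1. From arbitrary initial $\mathbf x_0,\mathbf Z_0,\bar\lambda_0$, for $k=0,1,\dots$: Step 1: let $\hat{\mathbf x}_k$ be the (unique) Nash equilibrium of the subgame in which player $i$ minimizes over $x_i\in\Omega_i$ the function $$\tilde f_i(x_i,\mathbf x_{-i})=f_i(x_i,\mathbf x_{-i})+\tfrac12\|x_i-x_{i,k}\|_{R_i}^2+\Big[\lambda_{i,k}+H_i\Big(A_ix_{i,k}+\sum_{l\in\mathcal E_i}V_{il}z_{l,k}-b_i\Big)\Big]^TA_ix_i;$$ choose any $\tilde{\mathbf x}_k=col(\tilde x_{1,k},\dots,\tilde x_{N,k})$ with $\|\tilde{\mathbf x}_k-\hat{\mathbf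 x}_k\|\le\mu_k$; set $x_{i,k+1}=x_{i,k}+\rho(\tilde x_{i,k}-x_{i,k})$. Step 2: $\lambda_{i,k+1}=\lambda_{i,k}+\rho H_i(A_i\tilde x_{i,k}+\sum_{l\in\mathcal E_i}V_{il}z_{l,k}-b_i)$. Step 3: let $s_{i,k}=\frac1\rho\lambda_{i,k+1}+\frac{\rho-1}{\rho}\lambda_{i,k}+H_i(A_i\tilde x_{i,k}+\sum_{l\in\mathcal E_i}V_{il}z_{l,k}-b_i)$; for each edge $e_l=i\to j$ set $z_{l,k+1}=z_{l,k}-\rho W_l(s_{j,k}-s_{i,k})$. Operator. $$\mathfrak M^e:\begin{pmatrix}\mathbf x\\ \mathbf Z\\ \bar\lambda\end{pmatrix}\mapsto\begin{pmatrix}\Lambda^T\bar\lambda+(N_{\bar\Omega}+\partial F)\mathbf x\\ \bar V^T\bar\lambda\\ -\Lambda\mathbf x-\bar V\mathbf Z+\bar b\end{pmatrix}.$$ *)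

theory Defs
  imports "HOL-Analysis.Analysis"
begin

definition subdifferential :: "'a::real_inner set \<Rightarrow> ('a \<Rightarrow> real) \<Rightarrow> 'a \<Rightarrow> 'a set" where
  "subdifferential D \<phi> x = {g. x \<in> D \<and> (\<forall>y\<in>D. \<phi> y \<ge> \<phi> x + g \<bullet> (y - x))}"

definition normal_cone :: "'a::real_inner set \<Rightarrow> 'a \<Rightarrow> 'a set" where
  "normal_cone S x = {v. x \<in> S \<and> (\<forall>y\<in>S. v \<bullet> (y - x) \<le> 0)}"

definition lsc_on :: "'a::topological_space set \<Rightarrow> ('a \<Rightarrow> real) \<Rightarrow> bool" where
  "lsc_on S \<phi> \<longleftrightarrow> (\<forall>x\<in>S. \<forall>c<\<phi> x. eventually (\<lambda>y. c < \<phi> y) (at x within S))"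

text \<open>
  For a real-valued function with effective domain \<open>D\<close> (that is, \<open>\<infinity>\<close> outside \<open>D\<close>),
  properness amounts to \<open>D \<noteq> {}\<close>.  For closed \<open>D\<close>, the only case used below, lower
  semicontinuity relative to \<open>D\<close> agrees with that of the extended function.
\<close>

definition proper_lsc_convex :: "'a::euclidean_space set \<Rightarrow> ('a \<Rightarrow> real) \<Rightarrow> bool" where
  "proper_lsc_convex D \<phi> \<longleftrightarrow> D \<noteq> {} \<and> lsc_on D \<phi> \<and> convex_on D \<phi>"

definition monotone_operator :: "('a::real_inner \<Rightarrow> 'a set) \<Rightarrow> bool" where
  "monotone_operator T \<longleftrightarrow> (\<forall>x y. \<forall>u\<in>T x. \<forall>v\<in>T y. (u - v) \<bullet> (x - y) \<ge> 0)"

definition maximally_monotone :: "('a::real_inner \<Rightarrow> 'a set) \<Rightarrow> bool" where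
  "maximally_monotone T \<longleftrightarrow> monotone_operator T \<and>
     (\<forall>T'. monotone_operator T' \<and> (\<forall>x. T x \<subseteq> T' x) \<longrightarrow> T' = T)"

definition zer :: "('a \<Rightarrow> 'b::zero set) \<Rightarrow> 'a set" where
  "zer T = {x. 0 \<in> T x}"

definition pos_def_on :: "(real ^ 'k) set \<Rightarrow> real ^ 'k ^ 'k \<Rightarrow> bool" where
  "pos_def_on S G \<longleftrightarrow> (\<forall>v\<in>S. v \<noteq> 0 \<longrightarrow> v \<bullet> (G *v v) > 0)"

abbreviation pos_def :: "real ^ 'k ^ 'k \<Rightarrow> bool" where
  "pos_def \<equiv> pos_def_on UNIV"

definition wnorm_sq :: "real ^ 'k ^ 'k \<Rightarrow> real ^ 'k \<Rightarrow> real" where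
  "wnorm_sq G x = x \<bullet> (G *v x)"

definition kron :: "real ^ 'b ^ 'a \<Rightarrow> real ^ 'd ^ 'c \<Rightarrow> real ^ ('b \<times> 'd) ^ ('a \<times> 'c)" where
  "kron P Q = (\<chi> r s. P $ fst r $ fst s * Q $ snd r $ snd s)"

definition kron_vec :: "real ^ 'a \<Rightarrow> real ^ 'b \<Rightarrow> real ^ ('a \<times> 'b)" where
  "kron_vec u v = (\<chi> r. u $ fst r * v $ snd r)"

text \<open>
  A stack of equally long vectors \<open>v\<^sub>q\<close> is a vector indexed by pairs \<open>(q, r)\<close>:
  \<open>part q\<close> extracts \<open>v\<^sub>q\<close>, and \<open>diag_blocks\<close> is the block diagonal matrix in these coordinates.
\<close>

definition col :: "('q::finite \<Rightarrow> real ^ 'm) \<Rightarrow> real ^ ('q \<times> 'm)" where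
  "col v = (\<chi> qr. v (fst qr) $ snd qr)"

definition part :: "'q::finite \<Rightarrow> real ^ ('q \<times> 'm) \<Rightarrow> real ^ 'm" where
  "part q v = (\<chi> r. v $ (q, r))"

definition diag_blocks :: "('q::finite \<Rightarrow> real ^ 'm ^ 'm) \<Rightarrow> real ^ ('q \<times> 'm) ^ ('q \<times> 'm)" where
  "diag_blocks G = (\<chi> r s. if fst r = fst s then G (fst r) $ snd r $ snd s else 0)"

text \<open>
  The coordinates of the stacked profile \<open>\<^bold>x \<in> \<real>\<^sup>n\<close> are indexed by the type \<open>'n\<close>, and
  \<open>own c\<close> is the player owning coordinate \<open>c\<close>; so \<open>n\<^sub>i = card {c. own c = i}\<close> may depend on \<open>i\<close>.
  Player \<open>i\<close>'s \<open>n\<^sub>i\<close>-dimensional space is identified with the coordinate subspace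
  \<open>strategy_space own i\<close> of \<open>\<real>\<^sup>n\<close>; matrices with \<open>n\<^sub>i\<close> rows or columns are correspondingly padded with zeros
  (\<open>padded_cols\<close>, \<open>padded_square\<close>).
\<close>

definition strategy_space :: "('n::finite \<Rightarrow> 'p) \<Rightarrow> 'p \<Rightarrow> (real ^ 'n) set" where
  "strategy_space own i = {u. \<forall>c. own c \<noteq> i \<longrightarrow> u $ c = 0}"

definition blk :: "('n::finite \<Rightarrow> 'p) \<Rightarrow> 'p \<Rightarrow> real ^ 'n \<Rightarrow> real ^ 'n" where
  "blk own i x = (\<chi> c. if own c = i then x $ c else 0)"

text \<open>The profile \<open>(u, \<^bold>x\<^sub>-\<^sub>i)\<close>; it does not depend on player \<open>i\<close>'s coordinates of \<open>\<^bold>x\<close>.\<close>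

definition deviate :: "('n::finite \<Rightarrow> 'p) \<Rightarrow> 'p \<Rightarrow> real ^ 'n \<Rightarrow> real ^ 'n \<Rightarrow> real ^ 'n" where
  "deviate own i u x = (\<chi> c. if own c = i then u $ c else x $ c)"

definition padded_cols :: "('n::finite \<Rightarrow> 'p) \<Rightarrow> 'p \<Rightarrow> real ^ 'n ^ 'm \<Rightarrow> bool" where
  "padded_cols own i B \<longleftrightarrow> (\<forall>r c. own c \<noteq> i \<longrightarrow> B $ r $ c = 0)"

definition padded_square :: "('n::finite \<Rightarrow> 'p) \<Rightarrow> 'p \<Rightarrow> real ^ 'n ^ 'n \<Rightarrow> bool" where
  "padded_square own i G \<longleftrightarrow> (\<forall>c d. own c \<noteq> i \<or> own d \<noteq> i \<longrightarrow> G $ c $ d = 0)"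

definition diag_R :: "('n::finite \<Rightarrow> 'p) \<Rightarrow> ('p \<Rightarrow> real ^ 'n ^ 'n) \<Rightarrow> real ^ 'n ^ 'n" where
  "diag_R own R = (\<chi> c d. if own c = own d then R (own c) $ c $ d else 0)"

definition Lam :: "('n::finite \<Rightarrow> 'p::finite) \<Rightarrow> ('p \<Rightarrow> real ^ 'n ^ 'm) \<Rightarrow> real ^ 'n ^ ('p \<times> 'm)" where
  "Lam own A = (\<chi> r c. if own c = fst r then A (fst r) $ snd r $ c else 0)"

definition Omega_bar :: "('n::finite \<Rightarrow> 'p) \<Rightarrow> ('p \<Rightarrow> (real ^ 'n) set) \<Rightarrow> (real ^ 'n) set" where
  "Omega_bar own \<Omega> = {x. \<forall>i. blk own i x \<in> \<Omega> i}"

text \<open>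
  A rival profile \<open>\<^bold>x\<^sub>-\<^sub>i\<close> is represented by any full profile with these components; everything
  below that takes \<open>\<^bold>x\<^sub>-\<^sub>i\<close> as an argument ignores the \<open>i\<close>-th component.
\<close>

definition rivals :: "('n::finite \<Rightarrow> 'p) \<Rightarrow> ('p \<Rightarrow> (real ^ 'n) set) \<Rightarrow> 'p \<Rightarrow> (real ^ 'n) set" where
  "rivals own \<Omega> i = {x. \<forall>j. j \<noteq> i \<longrightarrow> blk own j x \<in> \<Omega> j}"

definition shared_set ::
  "('n::finite \<Rightarrow> 'p::finite) \<Rightarrow> ('p \<Rightarrow> (real ^ 'n) set) \<Rightarrow> ('p \<Rightarrow> real ^ 'n ^ 'm) \<Rightarrow> ('p \<Rightarrow> real ^ 'm)
    \<Rightarrow> (real ^ 'n) set" where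
  "shared_set own \<Omega> A b =
     Omega_bar own \<Omega> \<inter> {x. (\<Sum>i\<in>UNIV. A i *v blk own i x) = (\<Sum>i\<in>UNIV. b i)}"

definition feasible ::
  "('n::finite \<Rightarrow> 'p::finite) \<Rightarrow> ('p \<Rightarrow> (real ^ 'n) set) \<Rightarrow> ('p \<Rightarrow> real ^ 'n ^ 'm) \<Rightarrow> ('p \<Rightarrow> real ^ 'm)
    \<Rightarrow> 'p \<Rightarrow> real ^ 'n \<Rightarrow> (real ^ 'n) set" where
  "feasible own \<Omega> A b i x = {u \<in> \<Omega> i. deviate own i u x \<in> shared_set own \<Omega> A b}"

text \<open>
  The objectives are functions \<open>f\<^sub>i\<close> from \<open>Omega_bar\<close> to the reals, so the domain of
  \<open>f\<^sub>i(\<cdot>, \<^bold>x\<^sub>-\<^sub>i)\<close> is \<open>\<Omega>\<^sub>i\<close>; values of \<open>f i\<close> outside \<open>Omega_bar\<close> are never used.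
\<close>

definition partial_subdiff ::
  "('n::finite \<Rightarrow> 'p) \<Rightarrow> ('p \<Rightarrow> (real ^ 'n) set) \<Rightarrow> ('p \<Rightarrow> real ^ 'n \<Rightarrow> real)
    \<Rightarrow> 'p \<Rightarrow> real ^ 'n \<Rightarrow> (real ^ 'n) set" where
  "partial_subdiff own \<Omega> f i x =
     strategy_space own i \<inter> subdifferential (\<Omega> i) (\<lambda>u. f i (deviate own i u x)) (blk own i x)"

definition pseudo_subdiff ::
  "('n::finite \<Rightarrow> 'p) \<Rightarrow> ('p \<Rightarrow> (real ^ 'n) set) \<Rightarrow> ('p \<Rightarrow> real ^ 'n \<Rightarrow> real)
    \<Rightarrow> real ^ 'n \<Rightarrow> (real ^ 'n) set" where
  "pseudo_subdiff own \<Omega> f x = {l. \<forall>i. blk own i l \<in> partial_subdiff own \<Omega> f i x}"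

definition GNE ::
  "('n::finite \<Rightarrow> 'p::finite) \<Rightarrow> ('p \<Rightarrow> (real ^ 'n) set) \<Rightarrow> ('p \<Rightarrow> real ^ 'n \<Rightarrow> real)
    \<Rightarrow> ('p \<Rightarrow> real ^ 'n ^ 'm) \<Rightarrow> ('p \<Rightarrow> real ^ 'm) \<Rightarrow> real ^ 'n \<Rightarrow> bool" where
  "GNE own \<Omega> f A b x \<longleftrightarrow>
     (\<forall>i. is_arg_min (\<lambda>u. f i (deviate own i u x)) (\<lambda>u. u \<in> feasible own \<Omega> A b i x) (blk own i x))"

definition GVI_solution ::
  "('n::finite \<Rightarrow> 'p::finite) \<Rightarrow> ('p \<Rightarrow> (real ^ 'n) set) \<Rightarrow> ('p \<Rightarrow> real ^ 'n \<Rightarrow> real)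
    \<Rightarrow> ('p \<Rightarrow> real ^ 'n ^ 'm) \<Rightarrow> ('p \<Rightarrow> real ^ 'm) \<Rightarrow> real ^ 'n \<Rightarrow> bool" where
  "GVI_solution own \<Omega> f A b x \<longleftrightarrow> x \<in> shared_set own \<Omega> A b \<and>
     (\<exists>l\<in>pseudo_subdiff own \<Omega> f x. \<forall>y\<in>shared_set own \<Omega> A b. l \<bullet> (y - x) \<ge> 0)"

definition variational_GNE ::
  "('n::finite \<Rightarrow> 'p::finite) \<Rightarrow> ('p \<Rightarrow> (real ^ 'n) set) \<Rightarrow> ('p \<Rightarrow> real ^ 'n \<Rightarrow> real)
    \<Rightarrow> ('p \<Rightarrow> real ^ 'n ^ 'm) \<Rightarrow> ('p \<Rightarrow> real ^ 'm) \<Rightarrow> real ^ 'n \<Rightarrow> bool" where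
  "variational_GNE own \<Omega> f A b x \<longleftrightarrow> GNE own \<Omega> f A b x \<and> GVI_solution own \<Omega> f A b x"

definition game_data ::
  "('n::finite \<Rightarrow> 'p) \<Rightarrow> ('p \<Rightarrow> (real ^ 'n) set) \<Rightarrow> ('p \<Rightarrow> real ^ 'n ^ 'm) \<Rightarrow> bool" where
  "game_data own \<Omega> A \<longleftrightarrow> (\<forall>i. \<Omega> i \<subseteq> strategy_space own i \<and> padded_cols own i (A i))"

definition assumption1 ::
  "('n::finite \<Rightarrow> 'p::finite) \<Rightarrow> ('p \<Rightarrow> (real ^ 'n) set) \<Rightarrow> ('p \<Rightarrow> real ^ 'n \<Rightarrow> real)
    \<Rightarrow> ('p \<Rightarrow> real ^ 'n ^ 'm) \<Rightarrow> ('p \<Rightarrow> real ^ 'm) \<Rightarrow> bool" where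
  "assumption1 own \<Omega> f A b \<longleftrightarrow>
     (\<forall>i. \<forall>x\<in>rivals own \<Omega> i. proper_lsc_convex (\<Omega> i) (\<lambda>u. f i (deviate own i u x))) \<and>
     maximally_monotone (pseudo_subdiff own \<Omega> f) \<and>
     (\<forall>i. closed (\<Omega> i) \<and> convex (\<Omega> i) \<and>
          top_of_set (strategy_space own i) interior_of (\<Omega> i) \<noteq> {}) \<and>
     rel_interior (shared_set own \<Omega> A b) \<noteq> {} \<and>
     (\<forall>i. \<forall>x\<in>rivals own \<Omega> i. rel_interior (feasible own \<Omega> A b i x) \<noteq> {})"

definition assumption2 ::
  "('n::finite \<Rightarrow> 'p::finite) \<Rightarrow> ('p \<Rightarrow> (real ^ 'n) set) \<Rightarrow> ('p \<Rightarrow> real ^ 'n \<Rightarrow> real)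
    \<Rightarrow> ('p \<Rightarrow> real ^ 'n ^ 'm) \<Rightarrow> ('p \<Rightarrow> real ^ 'm) \<Rightarrow> bool" where
  "assumption2 own \<Omega> f A b \<longleftrightarrow> (\<exists>x. GVI_solution own \<Omega> f A b x)"

text \<open>
  Edges are indexed by the type \<open>'e\<close>; \<open>src\<close> and \<open>tgt\<close> encode the edges together with
  their chosen orientation.  As HOL types are nonempty and loops are excluded, such a graph has
  at least two nodes.
\<close>

definition simple_graph :: "('e \<Rightarrow> 'p) \<Rightarrow> ('e \<Rightarrow> 'p) \<Rightarrow> bool" where
  "simple_graph src tgt \<longleftrightarrow> (\<forall>l. src l \<noteq> tgt l) \<and> inj (\<lambda>l. {src l, tgt l})"

definition connected_graph :: "('e \<Rightarrow> 'p) \<Rightarrow> ('e \<Rightarrow> 'p) \<Rightarrow> bool" where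
  "connected_graph src tgt \<longleftrightarrow>
     (\<forall>i j. (i, j) \<in> (range (\<lambda>l. (src l, tgt l)) \<union> range (\<lambda>l. (tgt l, src l)))\<^sup>*)"

definition incident :: "('e \<Rightarrow> 'p) \<Rightarrow> ('e \<Rightarrow> 'p) \<Rightarrow> 'p \<Rightarrow> 'e set" where
  "incident src tgt i = {l. tgt l = i} \<union> {l. src l = i}"

definition incidence :: "('e::finite \<Rightarrow> 'p::finite) \<Rightarrow> ('e \<Rightarrow> 'p) \<Rightarrow> real ^ 'e ^ 'p" where
  "incidence src tgt = (\<chi> i l. if tgt l = i then 1 else if src l = i then - 1 else 0)"

definition V_bar ::
  "('e::finite \<Rightarrow> 'p::finite) \<Rightarrow> ('e \<Rightarrow> 'p) \<Rightarrow> real ^ ('e \<times> 'm::finite) ^ ('p \<times> 'm)" where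
  "V_bar src tgt = kron (incidence src tgt) (mat 1)"

definition residual ::
  "('n::finite \<Rightarrow> 'p::finite) \<Rightarrow> ('p \<Rightarrow> real ^ 'n ^ 'm) \<Rightarrow> ('p \<Rightarrow> real ^ 'm)
    \<Rightarrow> ('e::finite \<Rightarrow> 'p) \<Rightarrow> ('e \<Rightarrow> 'p) \<Rightarrow> 'p \<Rightarrow> real ^ 'n \<Rightarrow> real ^ ('e \<times> 'm) \<Rightarrow> real ^ 'm" where
  "residual own A b src tgt i x Z =
     A i *v blk own i x + (\<Sum>l\<in>incident src tgt i. (incidence src tgt $ i $ l) *\<^sub>R part l Z) - b i"

definition subgame_objective ::
  "('n::finite \<Rightarrow> 'p::finite) \<Rightarrow> ('p \<Rightarrow> real ^ 'n \<Rightarrow> real) \<Rightarrow> ('p \<Rightarrow> real ^ 'n ^ 'm) \<Rightarrow> ('p \<Rightarrow> real ^ 'm)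
    \<Rightarrow> ('e::finite \<Rightarrow> 'p) \<Rightarrow> ('e \<Rightarrow> 'p) \<Rightarrow> ('p \<Rightarrow> real ^ 'n ^ 'n) \<Rightarrow> ('p \<Rightarrow> real ^ 'm ^ 'm)
    \<Rightarrow> real ^ 'n \<Rightarrow> real ^ ('e \<times> 'm) \<Rightarrow> real ^ ('p \<times> 'm) \<Rightarrow> 'p \<Rightarrow> real ^ 'n \<Rightarrow> real" where
  "subgame_objective own f A b src tgt R H xk Zk lamk i x =
     f i x + 1 / 2 * wnorm_sq (R i) (blk own i x - blk own i xk)
     + (part i lamk + H i *v residual own A b src tgt i xk Zk) \<bullet> (A i *v blk own i x)"

definition nash_equilibrium ::
  "('n::finite \<Rightarrow> 'p) \<Rightarrow> ('p \<Rightarrow> (real ^ 'n) set) \<Rightarrow> ('p \<Rightarrow> real ^ 'n \<Rightarrow> real) \<Rightarrow> real ^ 'n \<Rightarrow> bool" where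
  "nash_equilibrium own \<Omega> g x \<longleftrightarrow>
     (\<forall>i. is_arg_min (\<lambda>u. g i (deviate own i u x)) (\<lambda>u. u \<in> \<Omega> i) (blk own i x))"

text \<open>
  \<open>xh k\<close> is the exact subgame equilibrium and \<open>xt k\<close> its inexact version.
\<close>

definition algorithm1 ::
  "('n::finite \<Rightarrow> 'p::finite) \<Rightarrow> ('p \<Rightarrow> (real ^ 'n) set) \<Rightarrow> ('p \<Rightarrow> real ^ 'n \<Rightarrow> real)
    \<Rightarrow> ('p \<Rightarrow> real ^ 'n ^ 'm) \<Rightarrow> ('p \<Rightarrow> real ^ 'm) \<Rightarrow> ('e::finite \<Rightarrow> 'p) \<Rightarrow> ('e \<Rightarrow> 'p)
    \<Rightarrow> ('p \<Rightarrow> real ^ 'n ^ 'n) \<Rightarrow> ('p \<Rightarrow> real ^ 'm ^ 'm) \<Rightarrow> ('e \<Rightarrow> real ^ 'm ^ 'm)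
    \<Rightarrow> real \<Rightarrow> (nat \<Rightarrow> real)
    \<Rightarrow> (nat \<Rightarrow> real ^ 'n) \<Rightarrow> (nat \<Rightarrow> real ^ ('e \<times> 'm)) \<Rightarrow> (nat \<Rightarrow> real ^ ('p \<times> 'm)) \<Rightarrow> bool" where
  "algorithm1 own \<Omega> f A b src tgt R H W \<rho> \<mu> x Z lam \<longleftrightarrow>
     (\<exists>xh xt s. \<forall>k.
        nash_equilibrium own \<Omega>
          (subgame_objective own f A b src tgt R H (x k) (Z k) (lam k)) (xh k) \<and>
        norm (xt k - xh k) \<le> \<mu> k \<and>
        (\<forall>i. blk own i (x (Suc k))
               = blk own i (x k) + \<rho> *\<^sub>R (blk own i (xt k) - blk own i (x k))) \<and>
        (\<forall>i. part i (lam (Suc k))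
               = part i (lam k) + \<rho> *\<^sub>R (H i *v residual own A b src tgt i (xt k) (Z k))) \<and>
        (\<forall>i. s k i
               = (1 / \<rho>) *\<^sub>R part i (lam (Suc k)) + ((\<rho> - 1) / \<rho>) *\<^sub>R part i (lam k)
                 + H i *v residual own A b src tgt i (xt k) (Z k)) \<and>
        (\<forall>l. part l (Z (Suc k))
               = part l (Z k) - \<rho> *\<^sub>R (W l *v (s k (tgt l) - s k (src l)))))"

definition M_op ::
  "('n::finite \<Rightarrow> 'p::finite) \<Rightarrow> ('p \<Rightarrow> (real ^ 'n) set) \<Rightarrow> ('p \<Rightarrow> real ^ 'n \<Rightarrow> real)
    \<Rightarrow> ('p \<Rightarrow> real ^ 'n ^ 'm) \<Rightarrow> ('p \<Rightarrow> real ^ 'm) \<Rightarrow> ('e::finite \<Rightarrow> 'p) \<Rightarrow> ('e \<Rightarrow> 'p)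
    \<Rightarrow> (real ^ 'n) \<times> (real ^ ('e \<times> 'm)) \<times> (real ^ ('p \<times> 'm))
    \<Rightarrow> ((real ^ 'n) \<times> (real ^ ('e \<times> 'm)) \<times> (real ^ ('p \<times> 'm))) set" where
  "M_op own \<Omega> f A b src tgt = (\<lambda>(x, Z, lam).
     {(transpose (Lam own A) *v lam + (v + g),
       transpose (V_bar src tgt) *v lam,
       - (Lam own A *v x) - V_bar src tgt *v Z + col b) | v g.
       v \<in> normal_cone (Omega_bar own \<Omega>) x \<and> g \<in> pseudo_subdiff own \<Omega> f x})"

end

theory Submission
  imports Defs
begin

text \<open>
  Write \<open>w = (x, Z, \<lambda>)\<close> for the state of the algorithm, and \<open>L\<close>, \<open>V\<close>, \<open>H\<close>, \<open>W\<close>, \<open>R\<close> for the stacked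
  matrices. Let the players' subgame be solved exactly, with solution \<open>x'\<close>, and let
  \<open>\<lambda>' = \<lambda> + H (L x' + V Z - b)\<close>. The vector \<open>s\<close> of the third step is then \<open>2 \<lambda>' - \<lambda>\<close>; with
  \<open>Z' = Z - W V\<^sup>T (2 \<lambda>' - \<lambda>)\<close> and \<open>w' = (x', Z', \<lambda>')\<close>, one round of the algorithm is the relaxation
  \<open>w + \<rho> (w' - w)\<close>. The optimality conditions of the subgame and the two update rules combine into
  the single inclusion \<open>P (w - w') \<in> M w'\<close>, where \<open>M\<close> is the operator of the theorem and
  \<open>P (x, Z, \<lambda>) = ((R - L\<^sup>T H L) x, W\<^sup>-\<^sup>1 Z + V\<^sup>T \<lambda>, V Z + H\<^sup>-\<^sup>1 \<lambda>)\<close>.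
  So the algorithm is a proximal point iteration for \<open>M\<close>, relaxed by \<open>\<rho>\<close> and preconditioned by \<open>P\<close>, and
  the inaccuracy \<open>\<mu>\<^sub>k\<close> in the subgame changes a step by \<open>O(\<mu>\<^sub>k)\<close>
  (\<open>preconditioned_step\<close>, \<open>subgame_equilibrium_condition\<close>). Since \<open>P\<close> couples \<open>Z\<close> and \<open>\<lambda>\<close>, a Schur complement
  argument shows that the two definiteness hypotheses make it positive definite
  (\<open>weighted_norm_preconditioner\<close>).

  Convergence (\<open>inexact_relaxed_proximal_point\<close>) is a quasi-Fejer argument: in the norm weighted by \<open>P\<close>
  the distance to any zero of \<open>M\<close> increases by at most a summable amount, so it converges, while
  the steps \<open>w' - w\<close> tend to zero. A cluster point is a zero because the graph of \<open>M\<close> is closed, and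
  then the whole sequence must converge to it. Closedness of the graph comes from maximal monotonicity
  of the pseudo-subdifferential.

  The argument needs \<open>M\<close> to have a zero at all, which amounts to a Lagrange multiplier for a solution
  of the variational inequality (\<open>GVI_common_multiplier\<close>). It is obtained by separating the
  origin from a convex set of constraint and objective values. The separating functional could be degenerate,
  ignoring the objective; this is ruled out because each of at least two players can restore the
  coupling constraint alone, whatever the rivals play, since all feasible sets \<open>X\<^sub>i(x\<^sub>-\<^sub>i)\<close> are nonempty
  (\<open>functional_constant_if_everyone_can_balance\<close>).

  Conversely, at a zero of \<open>M\<close> the equation \<open>V\<^sup>T \<lambda> = 0\<close> makes the local multipliers agree along
  the edges, hence everywhere by connectedness, and summing the balance equations over the players
  eliminates \<open>Z\<close>. What remains is the multiplier condition for a variational equilibrium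
  (\<open>zer_M_op_variational_GNE\<close>).
\<close>

section \<open>Proximal point iterations in a weighted norm\<close>

lemma convergent_if_summable_increase:
  fixes a e :: "nat \<Rightarrow> real"
  assumes step: "\<And>k. a (Suc k) \<le> a k + e k" and nonneg: "\<And>k. 0 \<le> a k" "\<And>k. 0 \<le> e k"
    and sum: "summable e"
  shows "convergent a"
proof -
  \<comment> \<open>Removing the accumulated increases leaves a decreasing sequence.\<close>
  define d where "d k = a k - sum e {..<k}" for k
  have "decseq d" unfolding decseq_Suc_iff d_def using step by (simp add: algebra_simps)
  moreover have "- suminf e \<le> d k" for k
    using sum_le_suminf[OF sum, of "{..<k}"] nonneg[of k] nonneg(2) unfolding d_def by simp
  ultimately obtain L where L: "d \<longlonglongrightarrow> L" using decseq_convergent by metis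
  have "(\<lambda>k. d k + sum e {..<k}) \<longlonglongrightarrow> L + suminf e"
    using L summable_LIMSEQ[OF sum] by (intro tendsto_add)
  then show ?thesis unfolding d_def convergent_def by auto
qed

text \<open>
  A self-adjoint positive definite \<open>P\<close> defines an inner product \<open>x \<bullet> P y\<close>, in which distances to zeros
  are measured. Its norm is equivalent to the given one, so limits are the same for both.
\<close>
locale weighted_norm =
  fixes P :: "'a::euclidean_space \<Rightarrow> 'a"
  assumes lin: "linear P" and sym: "P x \<bullet> y = x \<bullet> P y" and pos: "x \<noteq> 0 \<Longrightarrow> 0 < x \<bullet> P x"
begin

definition wnorm :: "'a \<Rightarrow> real" where "wnorm x = sqrt (x \<bullet> P x)"

lemma form_nonneg: "0 \<le> x \<bullet> P x"
  using pos[of x] by (cases "x = 0") auto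

lemma wnorm_square: "(wnorm x)\<^sup>2 = x \<bullet> P x"
  using form_nonneg by (simp add: wnorm_def)

lemma wnorm_nonneg: "0 \<le> wnorm x"
  using form_nonneg by (simp add: wnorm_def)

lemma wnorm_square_add: "(wnorm (x + y))\<^sup>2 = (wnorm x)\<^sup>2 + 2 * (x \<bullet> P y) + (wnorm y)\<^sup>2"
  using sym[of x y] by (simp add: wnorm_square linear_add[OF lin] inner_simps inner_commute)

lemma wnorm_scale: "wnorm (c *\<^sub>R x) = \<bar>c\<bar> * wnorm x"
  by (simp add: wnorm_def linear_cmul[OF lin] real_sqrt_mult flip: mult.assoc)

lemma form_le_wnorm: "x \<bullet> P y \<le> wnorm x * wnorm y"
proof (cases "y = 0")
  case True
  then show ?thesis by (simp add: linear_0[OF lin] wnorm_def)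
next
  case False
  have yp: "0 < y \<bullet> P y" using pos False by blast
  \<comment> \<open>The value of \<open>t\<close> that minimizes the weighted norm of \<open>x + t y\<close>.\<close>
  define t where "t = - (x \<bullet> P y) / (y \<bullet> P y)"
  have "0 \<le> (wnorm (x + t *\<^sub>R y))\<^sup>2" by simp
  also have "\<dots> = x \<bullet> P x + 2 * t * (x \<bullet> P y) + t\<^sup>2 * (y \<bullet> P y)"
    unfolding wnorm_square_add by (simp add: wnorm_scale power_mult_distrib linear_cmul[OF lin] wnorm_square)
  also have "\<dots> = x \<bullet> P x - (x \<bullet> P y)\<^sup>2 / (y \<bullet> P y)"
    using yp by (simp add: t_def power2_eq_square field_simps)
  finally have "(x \<bullet> P y)\<^sup>2 \<le> (wnorm x * wnorm y)\<^sup>2"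
    using yp by (simp add: wnorm_square power_mult_distrib field_simps)
  then show ?thesis using wnorm_nonneg by (meson mult_nonneg_nonneg power2_le_imp_le)
qed

lemma wnorm_triangle: "wnorm (x + y) \<le> wnorm x + wnorm y"
proof -
  have "(wnorm (x + y))\<^sup>2 \<le> (wnorm x + wnorm y)\<^sup>2"
    using form_le_wnorm[of x y] by (simp add: wnorm_square_add power2_sum)
  then show ?thesis using wnorm_nonneg by (meson add_nonneg_nonneg power2_le_imp_le)
qed

lemma wnorm_upper: obtains C where "C > 0" "\<And>x. wnorm x \<le> C * norm x"
proof -
  obtain B where B: "B > 0" "\<And>x. norm (P x) \<le> B * norm x"
    using linear_bounded_pos[OF lin] by blast
  have "wnorm x \<le> sqrt B * norm x" for x
  proof -
    have "x \<bullet> P x \<le> norm x * norm (P x)" by (rule norm_cauchy_schwarz)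
    also have "\<dots> \<le> norm x * (B * norm x)" by (intro mult_left_mono B) simp
    finally have "x \<bullet> P x \<le> B * (norm x)\<^sup>2" by (simp add: power2_eq_square algebra_simps)
    then have "wnorm x \<le> sqrt (B * (norm x)\<^sup>2)" unfolding wnorm_def by (rule real_sqrt_le_mono)
    then show ?thesis by (simp add: real_sqrt_mult)
  qed
  then show ?thesis using that[of "sqrt B"] B by simp
qed

lemma wnorm_lower: obtains c where "c > 0" "\<And>x. c * norm x \<le> wnorm x"
proof -
  have "continuous_on (sphere 0 1) wnorm" unfolding wnorm_def
    by (intro continuous_intros linear_continuous_on linear_conv_bounded_linear[THEN iffD1] lin)
  then obtain x0 where x0: "x0 \<in> sphere 0 1" "\<And>y. y \<in> sphere 0 1 \<Longrightarrow> wnorm x0 \<le> wnorm y"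
    using continuous_attains_inf[of "sphere (0::'a) 1" wnorm] by auto
  have c: "wnorm x0 > 0" using x0(1) pos[of x0] by (cases "x0 = 0") (auto simp: wnorm_def)
  have "wnorm x0 * norm x \<le> wnorm x" for x
  proof (cases "x = 0")
    case False
    then have "wnorm x0 \<le> wnorm ((1 / norm x) *\<^sub>R x)" by (intro x0) simp
    then show ?thesis using False by (simp add: wnorm_scale field_simps)
  qed (simp add: wnorm_def)
  then show ?thesis using that c by blast
qed

text \<open>
  Here \<open>v k\<close> is the exact proximal point of \<open>w k\<close>. The proximal points are given, so closedness of the graph,
  which identifies cluster points as zeros, takes the place of maximality.
  For a zero \<open>z\<close>, monotonicity makes the angle between \<open>v k - w k\<close> and \<open>z - w k\<close> acute enough that
  every relaxation with \<open>\<rho> < 2\<close> still approaches \<open>z\<close>, with a gain proportional to the squared step.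
\<close>
theorem inexact_relaxed_proximal_point:
  assumes mono: "monotone_operator M" and closed: "closed {(x, u). u \<in> M x}"
    and zero: "z0 \<in> zer M"
    and rho: "0 < \<rho>" "\<rho> < 2"
    and prox: "\<And>k. P (w k - v k) \<in> M (v k)"
    and err: "\<And>k. norm (w (Suc k) - (w k + \<rho> *\<^sub>R (v k - w k))) \<le> e k" and sum: "summable e"
  shows "\<exists>z\<in>zer M. w \<longlonglongrightarrow> z"
proof -
  define d where "d k = v k - w k" for k
  obtain C where C: "C > 0" "\<And>x. wnorm x \<le> C * norm x" using wnorm_upper by blast
  obtain c where c: "c > 0" "\<And>x. c * norm x \<le> wnorm x" using wnorm_lower by blast
  have e0: "0 \<le> e k" for k using err[of k] norm_ge_zero order_trans by blast
  have sumC: "summable (\<lambda>k. C * e k)" using sum by (rule summable_mult)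
  have fejer: "(wnorm (w k - z + \<rho> *\<^sub>R d k))\<^sup>2 \<le> (wnorm (w k - z))\<^sup>2 - \<rho> * (2 - \<rho>) * (wnorm (d k))\<^sup>2"
    if "z \<in> zer M" for z k
  proof -
    have "0 \<le> (P (w k - v k) - 0) \<bullet> (v k - z)"
      using mono prox[of k] that unfolding monotone_operator_def zer_def by blast
    moreover have "P (w k - v k) = - P (d k)" "v k - z = (w k - z) + d k"
      by (auto simp: d_def linear_diff[OF lin])
    ultimately have "(w k - z) \<bullet> P (d k) \<le> - (wnorm (d k))\<^sup>2"
      by (simp add: wnorm_square inner_simps inner_commute)
    then have "2 * \<rho> * ((w k - z) \<bullet> P (d k)) \<le> 2 * \<rho> * - (wnorm (d k))\<^sup>2"
      using rho by (intro mult_left_mono) auto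
    moreover have "(wnorm (w k - z + \<rho> *\<^sub>R d k))\<^sup>2
        = (wnorm (w k - z))\<^sup>2 + 2 * \<rho> * ((w k - z) \<bullet> P (d k)) + \<rho>\<^sup>2 * (wnorm (d k))\<^sup>2"
      unfolding wnorm_square_add by (simp add: wnorm_scale linear_cmul[OF lin] power_mult_distrib)
    ultimately show ?thesis by (simp add: power2_eq_square left_diff_distrib right_diff_distrib)
  qed
  have relaxed_le: "wnorm (w k - z + \<rho> *\<^sub>R d k) \<le> wnorm (w k - z)" if "z \<in> zer M" for z k
  proof -
    have "0 \<le> \<rho> * (2 - \<rho>) * (wnorm (d k))\<^sup>2" using rho by simp
    then have "(wnorm (w k - z + \<rho> *\<^sub>R d k))\<^sup>2 \<le> (wnorm (w k - z))\<^sup>2"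
      using fejer[OF that, of k] by linarith
    then show ?thesis by (rule power2_le_imp_le[OF _ wnorm_nonneg])
  qed
  have next_le: "wnorm (w (Suc k) - z) \<le> wnorm (w k - z + \<rho> *\<^sub>R d k) + C * e k" for z k
  proof -
    have "w (Suc k) - z = (w k - z + \<rho> *\<^sub>R d k) + (w (Suc k) - (w k + \<rho> *\<^sub>R d k))" by simp
    then have "wnorm (w (Suc k) - z)
        \<le> wnorm (w k - z + \<rho> *\<^sub>R d k) + wnorm (w (Suc k) - (w k + \<rho> *\<^sub>R d k))"
      by (metis wnorm_triangle)
    also have "wnorm (w (Suc k) - (w k + \<rho> *\<^sub>R d k)) \<le> C * e k"
      using C(2) mult_left_mono[OF err[of k], of C] C(1) unfolding d_def
      by (meson less_imp_le order_trans)
    finally show ?thesis by simp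
  qed
  have conv: "convergent (\<lambda>k. wnorm (w k - z))" if "z \<in> zer M" for z
  proof (rule convergent_if_summable_increase[OF _ _ _ sumC])
    show "wnorm (w (Suc k) - z) \<le> wnorm (w k - z) + C * e k" for k
      using next_le[of k z] relaxed_le[OF that, of k] by linarith
  qed (use wnorm_nonneg C e0 in auto)
  obtain L where L: "(\<lambda>k. wnorm (w k - z0)) \<longlonglongrightarrow> L"
    using conv[OF zero] by (auto simp: convergent_def)
  \<comment> \<open>The distances before and after the relaxed step have the same limit, so the gain vanishes.\<close>
  have "d \<longlonglongrightarrow> 0"
  proof -
    have ez: "(\<lambda>k. C * e k) \<longlonglongrightarrow> 0" using sumC by (rule summable_LIMSEQ_zero)
    \<comment> \<open>The middle distance lies between the next one, up to the error, and the present one.\<close>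
    have "(\<lambda>k. wnorm (w k - z0 + \<rho> *\<^sub>R d k)) \<longlonglongrightarrow> L"
    proof (rule tendsto_sandwich[OF _ _ _ L])
      show "(\<lambda>k. wnorm (w (Suc k) - z0) - C * e k) \<longlonglongrightarrow> L"
        using tendsto_diff[OF LIMSEQ_Suc[OF L] ez] by simp
    qed (use next_le relaxed_le[OF zero] in \<open>auto simp: algebra_simps\<close>)
    then have lim: "(\<lambda>k. ((wnorm (w k - z0))\<^sup>2 - (wnorm (w k - z0 + \<rho> *\<^sub>R d k))\<^sup>2)
        / (c\<^sup>2 * \<rho> * (2 - \<rho>))) \<longlonglongrightarrow> (L\<^sup>2 - L\<^sup>2) / (c\<^sup>2 * \<rho> * (2 - \<rho>))"
      using L c rho by (intro tendsto_intros) auto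
    have "(\<lambda>k. (norm (d k))\<^sup>2) \<longlonglongrightarrow> 0"
    proof (rule tendsto_sandwich[OF _ _ tendsto_const lim[simplified]])
      show "\<forall>\<^sub>F k in sequentially. (norm (d k))\<^sup>2 \<le> ((wnorm (w k - z0))\<^sup>2
          - (wnorm (w k - z0 + \<rho> *\<^sub>R d k))\<^sup>2) / (c\<^sup>2 * \<rho> * (2 - \<rho>))"
      proof (rule always_eventually, rule allI)
        fix k
        have "(c * norm (d k))\<^sup>2 \<le> (wnorm (d k))\<^sup>2" using c by (intro power_mono) auto
        then have "\<rho> * (2 - \<rho>) * (c * norm (d k))\<^sup>2 \<le> \<rho> * (2 - \<rho>) * (wnorm (d k))\<^sup>2"
          using rho by (intro mult_left_mono) auto
        with fejer[OF zero, of k] have "(norm (d k))\<^sup>2 * (c\<^sup>2 * \<rho> * (2 - \<rho>))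
           \<le> (wnorm (w k - z0))\<^sup>2 - (wnorm (w k - z0 + \<rho> *\<^sub>R d k))\<^sup>2"
          by (simp add: power_mult_distrib algebra_simps)
        then show "(norm (d k))\<^sup>2 \<le> ((wnorm (w k - z0))\<^sup>2
          - (wnorm (w k - z0 + \<rho> *\<^sub>R d k))\<^sup>2) / (c\<^sup>2 * \<rho> * (2 - \<rho>))"
          using c rho by (subst pos_le_divide_eq) auto
      qed
    qed auto
    then show ?thesis
      using tendsto_norm_zero_iff power_tendsto_0_iff[of 2 "\<lambda>k. norm (d k)" sequentially] by force
  qed
  have "bounded (range w)"
  proof -
    obtain B where B: "\<And>k. norm (wnorm (w k - z0)) \<le> B"
      using convergent_imp_Bseq[OF conv[OF zero]] unfolding Bseq_def by blast
    have "norm (w k) \<le> B / c + norm z0" for k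
    proof -
      have "c * norm (w k - z0) \<le> B" using c(2) B[of k] by (smt (verit) real_norm_def)
      then have "norm (w k - z0) \<le> B / c" using c(1) by (simp add: field_simps)
      then show ?thesis using norm_triangle_sub[of "w k" z0] by linarith
    qed
    then show ?thesis by (auto simp: bounded_iff)
  qed
  then obtain z r where r: "strict_mono r" "(w \<circ> r) \<longlonglongrightarrow> z"
    using bounded_imp_convergent_subsequence by blast
  have dr: "(\<lambda>k. d (r k)) \<longlonglongrightarrow> 0"
    using LIMSEQ_subseq_LIMSEQ[OF \<open>d \<longlonglongrightarrow> 0\<close> r(1)] by (simp add: o_def)
  have wr: "(\<lambda>k. w (r k)) \<longlonglongrightarrow> z" using r(2) by (simp add: o_def)
  have "(\<lambda>k. P (- d (r k))) \<longlonglongrightarrow> P 0"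
    using tendsto_minus[OF dr] linear_continuous_at[OF lin[unfolded linear_conv_bounded_linear]]
    by (intro isCont_tendsto_compose[of _ P]) auto
  then have "(\<lambda>k. (w (r k) + d (r k), P (- d (r k)))) \<longlonglongrightarrow> (z, 0)"
    using tendsto_add[OF wr dr] by (intro tendsto_Pair) (auto simp: linear_0[OF lin])
  moreover have "(w (r k) + d (r k), P (- d (r k))) \<in> {(x, u). u \<in> M x}" for k
    using prox[of "r k"] by (simp add: d_def)
  ultimately have "(z, 0) \<in> {(x, u). u \<in> M x}"
    by (rule closed_sequentially[OF closed, rotated])
  then have z: "z \<in> zer M" by (simp add: zer_def)
  \<comment> \<open>The distance to the cluster point converges and is small along a subsequence, so it tends to 0.\<close>
  obtain L' where L': "(\<lambda>k. wnorm (w k - z)) \<longlonglongrightarrow> L'"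
    using conv[OF z] by (auto simp: convergent_def)
  have "(\<lambda>k. wnorm (w (r k) - z)) \<longlonglongrightarrow> 0"
  proof (rule tendsto_sandwich[OF _ _ tendsto_const])
    show "(\<lambda>k. C * norm (w (r k) - z)) \<longlonglongrightarrow> 0"
      using tendsto_mult_right_zero[OF tendsto_norm_zero[OF LIM_zero[OF wr]]] by blast
  qed (use C wnorm_nonneg in auto)
  then have "L' = 0"
    using LIMSEQ_unique LIMSEQ_subseq_LIMSEQ[OF L' r(1)] by (fastforce simp: o_def)
  have "(\<lambda>k. norm (w k - z)) \<longlonglongrightarrow> 0"
  proof (rule tendsto_sandwich[OF _ _ tendsto_const])
    show "(\<lambda>k. wnorm (w k - z) / c) \<longlonglongrightarrow> 0"
      using tendsto_divide[OF L' tendsto_const, of c] c \<open>L' = 0\<close> by simp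
    show "\<forall>\<^sub>F k in sequentially. norm (w k - z) \<le> wnorm (w k - z) / c"
      using c by (intro always_eventually allI) (simp add: field_simps)
  qed auto
  then have "w \<longlonglongrightarrow> z" using LIM_zero_cancel tendsto_norm_zero_iff by blast
  then show ?thesis using z by blast
qed

end

section \<open>Monotone operators and subdifferentials\<close>

text \<open>
  Maximality turns the graph into an intersection of closed conditions: a pair belongs to it as soon as
  it is monotonically related to every pair of the graph.
\<close>
lemma maximally_monotone_closed_graph:
  fixes T :: "'a::real_inner \<Rightarrow> 'a set"
  assumes "maximally_monotone T"
  shows "closed {(x, u). u \<in> T x}"
proof -
  have mono: "monotone_operator T"
    and maxi: "\<And>T'. monotone_operator T' \<Longrightarrow> (\<And>x. T x \<subseteq> T' x) \<Longrightarrow> T' = T"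
    using assms unfolding maximally_monotone_def by auto
  have "{(x, u). u \<in> T x} = (\<Inter>y. \<Inter>v\<in>T y. {(x, u). 0 \<le> (u - v) \<bullet> (x - y)})" (is "?G = ?I")
  proof
    show "?G \<subseteq> ?I" using mono unfolding monotone_operator_def by blast
    show "?I \<subseteq> ?G"
    proof clarify
      fix x u assume *: "(x, u) \<in> ?I"
      have "monotone_operator (T(x := insert u (T x)))"
        unfolding monotone_operator_def
      proof (intro allI ballI)
        fix x1 x2 u1 u2
        assume a: "u1 \<in> (T(x := insert u (T x))) x1" "u2 \<in> (T(x := insert u (T x))) x2"
        have "(u - v) \<bullet> (x - y) \<ge> 0" "(v - u) \<bullet> (y - x) \<ge> 0" if "v \<in> T y" for v y
          using * that by (fastforce simp: inner_simps inner_commute)+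
        then show "0 \<le> (u1 - u2) \<bullet> (x1 - x2)"
          using a mono unfolding monotone_operator_def
          by (cases "x1 = x \<and> u1 = u"; cases "x2 = x \<and> u2 = u") (auto split: if_splits)
      qed
      then have "T(x := insert u (T x)) = T" by (rule maxi) auto
      then show "u \<in> T x" by (metis fun_upd_same insertI1)
    qed
  qed
  moreover have "closed {(x, u). 0 \<le> (u - v) \<bullet> (x - y)}" for v y :: 'a
    unfolding case_prod_beta by (intro closed_Collect_le continuous_intros)
  ultimately show ?thesis by (auto intro!: closed_INT)
qed

text \<open>
  Moving from the minimizer \<open>x\<close> a small distance \<open>t\<close> towards \<open>y\<close> changes the quadratic and linear
  terms by their derivative up to \<open>O(t\<^sup>2)\<close>, and \<open>\<phi>\<close> by at most \<open>t (\<phi> y - \<phi> x)\<close>. Dividing by \<open>t\<close> and letting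
  it vanish gives the subgradient inequality.
\<close>
lemma subdifferential_if_prox_minimizer:
  fixes G :: "real ^ 'n ^ 'n"
  assumes conv: "convex_on S \<phi>" and sym: "transpose G = G"
    and min: "is_arg_min (\<lambda>u. \<phi> u + 1 / 2 * wnorm_sq G (u - c) + p \<bullet> u) (\<lambda>u. u \<in> S) x"
  shows "- (G *v (x - c) + p) \<in> subdifferential S \<phi> x"
proof -
  have xS: "x \<in> S" and le: "\<And>u. u \<in> S \<Longrightarrow>
      \<phi> x + 1 / 2 * wnorm_sq G (x - c) + p \<bullet> x \<le> \<phi> u + 1 / 2 * wnorm_sq G (u - c) + p \<bullet> u"
    using min by (auto simp: is_arg_min_def not_less)
  have "\<phi> x + - (G *v (x - c) + p) \<bullet> (y - x) \<le> \<phi> y" if y: "y \<in> S" for y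
  proof (rule ccontr)
    assume neg: "\<not> ?thesis"
    define h where "h = y - x"
    define q where "q = h \<bullet> (G *v h)"
    \<comment> \<open>The amount by which the subgradient inequality is supposed to fail.\<close>
    define \<delta> where "\<delta> = \<phi> x - (G *v (x - c) + p) \<bullet> h - \<phi> y"
    have \<delta>: "\<delta> > 0" using neg unfolding \<delta>_def h_def inner_minus_left by linarith
    have bound: "\<delta> \<le> t * q / 2" if t: "0 < t" "t \<le> 1" for t
    proof -
      have "x + t *\<^sub>R h = (1 - t) *\<^sub>R x + t *\<^sub>R y" by (simp add: h_def algebra_simps)
      then have S: "x + t *\<^sub>R h \<in> S" and "\<phi> (x + t *\<^sub>R h) \<le> (1 - t) * \<phi> x + t * \<phi> y"
        using conv t xS y convex_onD[OF conv, of t x y] unfolding convex_on_def convex_alt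
        by auto
      moreover have "wnorm_sq G (x + t *\<^sub>R h - c)
          = wnorm_sq G (x - c) + 2 * t * ((G *v (x - c)) \<bullet> h) + t\<^sup>2 * q"
      proof -
        define e where "e = x - c"
        have "u \<bullet> (G *v w) = (G *v u) \<bullet> w" for u w
          by (metis dot_lmul_matrix sym transpose_matrix_vector)
        then have "wnorm_sq G (e + t *\<^sub>R h) = wnorm_sq G e + 2 * t * ((G *v e) \<bullet> h) + t\<^sup>2 * q"
          unfolding wnorm_sq_def q_def
          by (simp add: matrix_vector_right_distrib matrix_vector_mult_scaleR inner_add_left
              inner_add_right power2_eq_square inner_commute algebra_simps)
        then show ?thesis by (simp add: e_def algebra_simps)
      qed
      ultimately have "0 \<le> t * (\<phi> y - \<phi> x) + t * ((G *v (x - c)) \<bullet> h) + t\<^sup>2 * q / 2 + t * (p \<bullet> h)"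
        using le[OF S] by (simp add: inner_simps algebra_simps)
      then have "0 \<le> t * (t * q / 2 - \<delta>)"
        by (simp add: \<delta>_def inner_simps power2_eq_square algebra_simps)
      then show ?thesis using t by (simp add: zero_le_mult_iff)
    qed
    have "(\<lambda>n. (1 / real (Suc n)) * q / 2) \<longlonglongrightarrow> 0 * q / 2"
      by (intro tendsto_intros LIMSEQ_inverse_real_of_nat[unfolded inverse_eq_divide]) simp
    moreover have "\<forall>n\<ge>0. \<delta> \<le> 1 / real (Suc n) * q / 2" by (intro allI impI bound) auto
    ultimately have "\<delta> \<le> 0 * q / 2" by (rule Lim_bounded2)
    then show False using \<delta> by simp
  qed
  then show ?thesis using xS by (simp add: subdifferential_def)
qed

section \<open>Stacked vectors and block matrices\<close>

lemma sum_UNIV_prod: "(\<Sum>x\<in>UNIV. g x) = (\<Sum>a\<in>UNIV. \<Sum>b\<in>UNIV. g (a, b))"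
  for g :: "'a::finite \<times> 'b::finite \<Rightarrow> 'c::comm_monoid_add"
  by (simp add: sum.cartesian_product UNIV_Times_UNIV[symmetric] del: UNIV_Times_UNIV)

lemma inner_matrix_transpose: "x \<bullet> (B *v y) = (transpose B *v x) \<bullet> y" for B :: "real ^ 'n ^ 'm"
  by (simp add: dot_lmul_matrix transpose_matrix_vector)

text \<open>
  Transposes are moved across inner products below, for which \<open>transpose B *v x\<close> has to stay intact.
\<close>

declare transpose_matrix_vector [simp del]

lemma part_add [simp]: "part q (u + v) = part q u + part q v"
  and part_diff [simp]: "part q (u - v) = part q u - part q v"
  and part_zero [simp]: "part q 0 = 0"
  and part_scaleR [simp]: "part q (c *\<^sub>R u) = c *\<^sub>R part q u"
  and part_col [simp]: "part q (col g) = g q"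
  and part_kron_vec: "part q (kron_vec a w) = a $ q *\<^sub>R w"
  by (simp_all add: part_def col_def kron_vec_def vec_eq_iff)

lemma part_eqI: "(\<And>q. part q u = part q v) \<Longrightarrow> u = v"
  by (simp add: part_def vec_eq_iff)

lemma inner_part: "u \<bullet> v = (\<Sum>q\<in>UNIV. part q u \<bullet> part q v)"
  by (simp add: inner_vec_def sum_UNIV_prod part_def)

lemma part_diag_blocks: "part q (diag_blocks G *v v) = G q *v part q v"
proof -
  have "(\<Sum>a\<in>UNIV. \<Sum>s\<in>UNIV. (if q = a then G q $ r $ s else 0) * v $ (a, s))
      = (\<Sum>s\<in>UNIV. G q $ r $ s * v $ (q, s))" for r
  proof -
    have "(\<Sum>a\<in>UNIV. \<Sum>s\<in>UNIV. (if q = a then G q $ r $ s else 0) * v $ (a, s))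
      = (\<Sum>a\<in>UNIV. if q = a then \<Sum>s\<in>UNIV. G q $ r $ s * v $ (a, s) else 0)"
      by (intro sum.cong) auto
    then show ?thesis by simp
  qed
  then show ?thesis
    by (simp add: vec_eq_iff part_def diag_blocks_def matrix_vector_mult_def sum_UNIV_prod
        cong: if_cong)
qed

lemma transpose_diag_blocks:
  assumes "\<And>q. transpose (G q) = G q"
  shows "transpose (diag_blocks G) = diag_blocks G"
proof -
  have "G q $ r $ s = G q $ s $ r" for q r s
    using assms[of q] by (simp add: transpose_def vec_eq_iff)
  then show ?thesis by (simp add: transpose_def diag_blocks_def vec_eq_iff)
qed

lemma pos_def_diag_blocks:
  assumes "\<And>q. pos_def (G q)"
  shows "pos_def (diag_blocks G)"
  unfolding pos_def_on_def
proof (intro ballI impI)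
  fix v :: "real ^ ('a \<times> 'b)" assume "v \<noteq> 0"
  then obtain q where q: "part q v \<noteq> 0" by (metis part_eqI part_zero)
  have nn: "0 \<le> part q v \<bullet> (G q *v part q v)" for q
    using assms[of q] by (cases "part q v = 0") (auto simp: pos_def_on_def less_imp_le)
  have "0 < (\<Sum>q\<in>UNIV. part q v \<bullet> (G q *v part q v))"
    using q assms[of q] by (intro sum_pos2[of UNIV q]) (auto simp: pos_def_on_def nn)
  then show "0 < v \<bullet> (diag_blocks G *v v)" by (simp add: inner_part part_diag_blocks)
qed

lemma blk_add: "blk own i (x + y) = blk own i x + blk own i y"
  and blk_diff: "blk own i (x - y) = blk own i x - blk own i y"
  and blk_scaleR: "blk own i (c *\<^sub>R x) = c *\<^sub>R blk own i x"
  and blk_minus: "blk own i (- x) = - blk own i x"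
  by (simp_all add: blk_def vec_eq_iff)

lemma blk_in_strategy_space [simp]: "blk own i x \<in> strategy_space own i"
  by (simp add: blk_def strategy_space_def)

lemma blk_eqI: "(\<And>i. blk own i x = blk own i y) \<Longrightarrow> x = y"
  by (simp add: blk_def vec_eq_iff) metis

lemma blk_inner: "blk own i x \<bullet> y = x \<bullet> blk own i y"
  by (auto simp: inner_vec_def blk_def intro!: sum.cong)

lemma blk_blk: "blk own i (blk own i x) = blk own i x"
  by (simp add: blk_def vec_eq_iff)

lemma blk_strategy: "u \<in> strategy_space own i \<Longrightarrow> blk own i u = u"
  by (auto simp add: blk_def vec_eq_iff strategy_space_def)

lemma deviate_blk [simp]: "deviate own i (blk own i x) x = x"
  by (simp add: deviate_def blk_def vec_eq_iff)

lemma blk_deviate: "blk own i (deviate own i u x) = blk own i u"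
  and blk_deviate_other: "j \<noteq> i \<Longrightarrow> blk own j (deviate own i u x) = blk own j x"
  by (simp_all add: deviate_def blk_def vec_eq_iff)

lemma deviate_diff: "deviate own i u x - x = blk own i (u - x)"
  by (simp add: deviate_def blk_def vec_eq_iff)

lemma blk_diag_R:
  assumes "padded_square own i (R i)"
  shows "blk own i (diag_R own R *v x) = R i *v blk own i x"
proof -
  have "R i $ c $ d = 0" if "own c \<noteq> i \<or> own d \<noteq> i" for c d
    using assms that by (simp add: padded_square_def)
  then show ?thesis
    by (auto simp: vec_eq_iff blk_def diag_R_def matrix_vector_mult_def intro!: sum.cong)
qed

lemma transpose_diag_R:
  assumes "\<And>i. transpose (R i) = R i"
  shows "transpose (diag_R own R) = diag_R own R"
proof -
  have "R i $ r $ s = R i $ s $ r" for i r s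
    using assms[of i] by (simp add: transpose_def vec_eq_iff)
  then show ?thesis by (simp add: transpose_def diag_R_def vec_eq_iff)
qed

lemma part_Lam: "part i (Lam own A *v x) = A i *v blk own i x"
  by (auto simp: vec_eq_iff part_def Lam_def blk_def matrix_vector_mult_def intro!: sum.cong)

lemma blk_transpose_Lam:
  assumes "padded_cols own i (A i)"
  shows "blk own i (transpose (Lam own A) *v u) = transpose (A i) *v part i u"
proof -
  have z: "A i $ r $ c = 0" if "own c \<noteq> i" for r c
    using assms that by (simp add: padded_cols_def)
  have "(\<Sum>j\<in>UNIV. \<Sum>r\<in>UNIV. (if own c = j then A j $ r $ c else 0) * u $ (j, r))
      = (\<Sum>r\<in>UNIV. A (own c) $ r $ c * u $ (own c, r))" for c
  proof -
    have "(\<Sum>j\<in>UNIV. \<Sum>r\<in>UNIV. (if own c = j then A j $ r $ c else 0) * u $ (j, r))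
      = (\<Sum>j\<in>UNIV. if own c = j then \<Sum>r\<in>UNIV. A j $ r $ c * u $ (j, r) else 0)"
      by (intro sum.cong) auto
    then show ?thesis by simp
  qed
  then show ?thesis
    using z by (auto simp: vec_eq_iff part_def Lam_def blk_def matrix_vector_mult_def transpose_def
        sum_UNIV_prod cong: if_cong)
qed

lemma part_V_bar:
  "part i (V_bar src tgt *v Z)
    = (\<Sum>l\<in>incident src tgt i. (incidence src tgt $ i $ l) *\<^sub>R part l Z)"
proof -
  have d: "(\<Sum>s\<in>UNIV. a * (if r = s then 1 else 0) * g s) = a * g r"
    for a :: real and r :: "'d::finite" and g
    by (simp add: if_distrib[of "\<lambda>t. _ * t * _"] cong: if_cong)
  have "part i (V_bar src tgt *v Z) = (\<Sum>l\<in>UNIV. (incidence src tgt $ i $ l) *\<^sub>R part l Z)"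
    by (simp add: vec_eq_iff part_def V_bar_def kron_def mat_def matrix_vector_mult_def
        sum_UNIV_prod d)
  also have "\<dots> = (\<Sum>l\<in>incident src tgt i. (incidence src tgt $ i $ l) *\<^sub>R part l Z)"
    by (intro sum.mono_neutral_right) (auto simp: incident_def incidence_def)
  finally show ?thesis .
qed

text \<open>
  The matrix \<open>V\<^sup>T\<close> takes differences along the edges. A loop would give the incidence
  matrix a column with a single entry 1 instead.
\<close>
lemma part_transpose_V_bar:
  assumes "src l \<noteq> tgt l"
  shows "part l (transpose (V_bar src tgt) *v u) = part (tgt l) u - part (src l) u"
proof -
  have d: "(\<Sum>s\<in>UNIV. a * (if s = r then 1 else 0) * g s) = a * g r"
    for a :: real and r :: "'d::finite" and g
    by (simp add: if_distrib[of "\<lambda>t. _ * t * _"] cong: if_cong)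
  have "(if tgt l = i then 1 else if src l = i then -1 else 0) * y
      = (if tgt l = i then y else 0) - (if src l = i then y else 0)" for i and y :: real
    using assms by auto
  then show ?thesis
    by (simp add: vec_eq_iff part_def V_bar_def kron_def mat_def matrix_vector_mult_def
        transpose_def sum_UNIV_prod d incidence_def sum_subtractf cong: if_cong)
qed

text \<open>
  The quantity that player \<open>i\<close> computes from its own block and its incident edges is its block of one
  vector in stacked form.
\<close>
lemma part_residual: "residual own A b src tgt i x Z = part i (Lam own A *v x + V_bar src tgt *v Z - col b)"
  by (simp add: residual_def part_Lam part_V_bar)

lemma consensus_if_edges_agree:
  assumes conn: "connected_graph src tgt" and loops: "\<And>l. src l \<noteq> tgt l"
    and ker: "transpose (V_bar src tgt) *v u = 0"
  shows "\<exists>l. u = kron_vec (\<chi> i. 1) l"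
proof -
  have edge: "part (tgt l) u = part (src l) u" for l
    using part_transpose_V_bar[of src l tgt u] loops[of l] ker by simp
  have "part i u = part j u" for i j
  proof -
    have "(i, j) \<in> (range (\<lambda>l. (src l, tgt l)) \<union> range (\<lambda>l. (tgt l, src l)))\<^sup>*"
      using conn by (simp add: connected_graph_def)
    then show ?thesis by (induction rule: rtrancl_induct) (use edge in auto)
  qed
  then have "u = kron_vec (\<chi> i. 1) (part undefined u)"
    by (intro part_eqI) (simp add: part_kron_vec)
  then show ?thesis by blast
qed

lemma transpose_V_bar_kron_one:
  assumes "\<And>l. src l \<noteq> tgt l"
  shows "transpose (V_bar src tgt) *v kron_vec (\<chi> i. 1) l = 0"
  by (intro part_eqI)
    (simp add: part_transpose_V_bar assms part_kron_vec)

lemma kron_one_inner: "kron_vec (\<chi> i. 1) l \<bullet> u = l \<bullet> (\<Sum>i\<in>UNIV. part i u)"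
  by (simp add: inner_part part_kron_vec inner_sum_right)

text \<open>
  The range of \<open>V\<close> is the orthogonal complement of the kernel of \<open>V\<^sup>T\<close>, which for a connected graph consists
  of the consensus vectors. Hence a mismatch that cancels in total can be routed through the edges.
\<close>
lemma range_V_bar:
  fixes src tgt :: "'e::finite \<Rightarrow> 'p::finite" and r :: "real ^ ('p \<times> 'm::finite)"
  assumes conn: "connected_graph src tgt" and loops: "\<And>l. src l \<noteq> tgt l"
    and zero: "(\<Sum>i\<in>UNIV. part i r) = 0"
  shows "\<exists>Z. V_bar src tgt *v Z = r"
proof -
  let ?V = "V_bar src tgt :: real ^ ('e \<times> 'm) ^ ('p \<times> 'm)"
  have sub: "span (range ((*v) ?V)) = range ((*v) ?V)"
    by (simp add: span_eq_iff linear_subspace_image)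
  obtain p q where p: "p \<in> span (range ((*v) ?V))" and r: "r = p + q"
    and q: "\<And>w. w \<in> span (range ((*v) ?V)) \<Longrightarrow> orthogonal q w"
    using orthogonal_subspace_decomp_exists[of "range ((*v) ?V)" r] by metis
  obtain Z where Z: "p = ?V *v Z" using p sub by auto
  have orth: "q \<bullet> (?V *v Z) = 0" for Z
    using q[of "?V *v Z"] sub by (simp add: orthogonal_def)
  then have "transpose ?V *v q = 0"
    by (metis inner_eq_zero_iff inner_matrix_transpose)
  then obtain l where "q = kron_vec (\<chi> i. 1) l"
    using consensus_if_edges_agree[OF conn loops] by blast
  then have "q \<bullet> r = 0" by (simp add: kron_one_inner zero)
  then have "q = 0" using orth[of Z] r Z by (simp add: inner_simps)
  then show ?thesis using Z r by auto
qed

section \<open>Variational equilibria and multipliers\<close>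

lemma Omega_bar_deviate:
  assumes "game_data own \<Omega> A" and "u \<in> \<Omega> i" and "x \<in> rivals own \<Omega> i"
  shows "deviate own i u x \<in> Omega_bar own \<Omega>"
proof -
  have "blk own i u = u" using assms by (intro blk_strategy) (auto simp: game_data_def)
  then have "blk own j (deviate own i u x) \<in> \<Omega> j" for j
    using assms by (cases "j = i") (auto simp: blk_deviate blk_deviate_other rivals_def)
  then show ?thesis by (simp add: Omega_bar_def)
qed

lemma Omega_bar_rivals: "x \<in> Omega_bar own \<Omega> \<Longrightarrow> x \<in> rivals own \<Omega> i"
  by (simp add: Omega_bar_def rivals_def)

lemma pseudo_subdiff_iff:
  "l \<in> pseudo_subdiff own \<Omega> f x \<longleftrightarrow> x \<in> Omega_bar own \<Omega> \<and>
    (\<forall>i. \<forall>u\<in>\<Omega> i. f i x + blk own i l \<bullet> (u - blk own i x) \<le> f i (deviate own i u x))"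
  by (auto simp: pseudo_subdiff_def partial_subdiff_def subdifferential_def Omega_bar_def)

text \<open>
  Converts between a player's own subgradient inequality and inner products of full profiles.
\<close>
lemma blk_inner_deviation: "blk own i l \<bullet> (u - blk own i x) = l \<bullet> (deviate own i u x - x)"
proof -
  have "blk own i l \<bullet> (u - blk own i x) = blk own i l \<bullet> blk own i (u - blk own i x)"
    by (metis blk_blk blk_inner)
  then show ?thesis by (simp add: deviate_diff blk_diff blk_blk blk_inner)
qed

text \<open>
  The partial subdifferentials are taken relative to the strategy sets \<open>\<Omega> i\<close>, so they already contain the
  normals of these sets. This lets the normal cone be dropped from the operator \<open>M_op\<close>.
\<close>
lemma pseudo_subdiff_normal_cone:
  assumes "game_data own \<Omega> A" and l: "l \<in> pseudo_subdiff own \<Omega> f x"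
    and v: "v \<in> normal_cone (Omega_bar own \<Omega>) x"
  shows "v + l \<in> pseudo_subdiff own \<Omega> f x"
proof -
  have x: "x \<in> Omega_bar own \<Omega>" using l by (simp add: pseudo_subdiff_iff)
  have "f i x + blk own i (v + l) \<bullet> (u - blk own i x) \<le> f i (deviate own i u x)" if "u \<in> \<Omega> i" for i u
  proof -
    have "v \<bullet> (deviate own i u x - x) \<le> 0"
      using v Omega_bar_deviate[OF assms(1) that Omega_bar_rivals[OF x]] by (simp add: normal_cone_def)
    moreover have "f i x + blk own i l \<bullet> (u - blk own i x) \<le> f i (deviate own i u x)"
      using l that by (simp add: pseudo_subdiff_iff)
    ultimately show ?thesis by (simp add: blk_add inner_add_left blk_inner_deviation)
  qed
  then show ?thesis using x by (simp add: pseudo_subdiff_iff)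
qed

lemma M_op_without_normal_cone:
  assumes "game_data own \<Omega> A"
  shows "M_op own \<Omega> f A b src tgt (x, Z, lam) =
    {(transpose (Lam own A) *v lam + g, transpose (V_bar src tgt) *v lam,
      - (Lam own A *v x) - V_bar src tgt *v Z + col b) | g. g \<in> pseudo_subdiff own \<Omega> f x}"
    (is "?L = ?R")
proof
  show "?L \<subseteq> ?R" unfolding M_op_def using pseudo_subdiff_normal_cone[OF assms] by force
  have "0 \<in> normal_cone (Omega_bar own \<Omega>) x" if "g \<in> pseudo_subdiff own \<Omega> f x" for g
    using that by (simp add: normal_cone_def pseudo_subdiff_iff)
  then show "?R \<subseteq> ?L" unfolding M_op_def by force
qed

text \<open>
  The linear coupling between profile, edge variables and multipliers is skew, so it contributes nothing to
  the inner product and monotonicity is that of the pseudo-subdifferential.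
\<close>
lemma monotone_M_op:
  assumes gd: "game_data own \<Omega> A" and mono: "monotone_operator (pseudo_subdiff own \<Omega> f)"
  shows "monotone_operator (M_op own \<Omega> f A b src tgt)"
  unfolding monotone_operator_def
proof (clarify)
  fix x Z lam x' Z' lam' u1 u2 u3 v1 v2 v3
  assume "(u1, u2, u3) \<in> M_op own \<Omega> f A b src tgt (x, Z, lam)"
    and "(v1, v2, v3) \<in> M_op own \<Omega> f A b src tgt (x', Z', lam')"
  then obtain g g' where g: "g \<in> pseudo_subdiff own \<Omega> f x" "g' \<in> pseudo_subdiff own \<Omega> f x'"
    and u: "u1 = transpose (Lam own A) *v lam + g" "u2 = transpose (V_bar src tgt) *v lam"
      "u3 = - (Lam own A *v x) - V_bar src tgt *v Z + col b"
    and v: "v1 = transpose (Lam own A) *v lam' + g'" "v2 = transpose (V_bar src tgt) *v lam'"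
      "v3 = - (Lam own A *v x') - V_bar src tgt *v Z' + col b"
    unfolding M_op_without_normal_cone[OF gd] by blast
  have "u1 - v1 = transpose (Lam own A) *v (lam - lam') + (g - g')"
    "u2 - v2 = transpose (V_bar src tgt) *v (lam - lam')"
    "u3 - v3 = - (Lam own A *v (x - x')) - V_bar src tgt *v (Z - Z')"
    unfolding u v by (simp_all add: matrix_vector_mult_diff_distrib)
  then have "(u1 - v1) \<bullet> (x - x') + (u2 - v2) \<bullet> (Z - Z') + (u3 - v3) \<bullet> (lam - lam')
      = (g - g') \<bullet> (x - x')"
    using inner_commute[of "lam - lam'" "Lam own A *v (x - x')"]
      inner_commute[of "lam - lam'" "V_bar src tgt *v (Z - Z')"]
    by (simp only: inner_add_left inner_diff_left[of "- _"] inner_minus_left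
        inner_matrix_transpose[symmetric])
  then show "0 \<le> ((u1, u2, u3) - (v1, v2, v3)) \<bullet> ((x, Z, lam) - (x', Z', lam'))"
    using mono g by (simp add: monotone_operator_def inner_Pair add.assoc)
qed

text \<open>
  Membership in the graph says that two linear equations hold and that a linear image of the point lies in
  the graph of the pseudo-subdifferential.
\<close>
lemma closed_graph_M_op:
  fixes own :: "'n::finite \<Rightarrow> 'p::finite" and A :: "'p \<Rightarrow> real ^ 'n ^ 'm::finite"
    and src tgt :: "'e::finite \<Rightarrow> 'p"
  assumes gd: "game_data own \<Omega> A" and maxi: "maximally_monotone (pseudo_subdiff own \<Omega> f)"
  shows "closed {(w, u). u \<in> M_op own \<Omega> f A b src tgt w}"
proof -
  let ?L = "Lam own A" and ?V = "V_bar src tgt"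
  let ?G = "{(x, g). g \<in> pseudo_subdiff own \<Omega> f x}"
  let ?h = "\<lambda>p. (fst (fst p), fst (snd p) - transpose ?L *v snd (snd (fst p)))"
  have eq: "{(w, u). u \<in> M_op own \<Omega> f A b src tgt w} = ?h -` ?G
      \<inter> {p. fst (snd (snd p)) = transpose ?V *v snd (snd (fst p))}
      \<inter> {p. snd (snd (snd p)) = - (?L *v fst (fst p)) - ?V *v fst (snd (fst p)) + col b}"
  proof (intro set_eqI)
    fix p :: "((real ^ 'n) \<times> (real ^ ('e \<times> 'm)) \<times> (real ^ ('p \<times> 'm)))
      \<times> ((real ^ 'n) \<times> (real ^ ('e \<times> 'm)) \<times> (real ^ ('p \<times> 'm)))"
    obtain x Z lam u1 u2 u3 where p: "p = ((x, Z, lam), (u1, u2, u3))" by (metis surj_pair)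
    have "(\<exists>g. u1 = transpose ?L *v lam + g \<and> g \<in> pseudo_subdiff own \<Omega> f x)
        \<longleftrightarrow> u1 - transpose ?L *v lam \<in> pseudo_subdiff own \<Omega> f x"
      by (metis add_diff_cancel_left' diff_add_cancel add.commute)
    then show "p \<in> {(w, u). u \<in> M_op own \<Omega> f A b src tgt w} \<longleftrightarrow> p \<in> ?h -` ?G
      \<inter> {p. fst (snd (snd p)) = transpose ?V *v snd (snd (fst p))}
      \<inter> {p. snd (snd (snd p)) = - (?L *v fst (fst p)) - ?V *v fst (snd (fst p)) + col b}"
      unfolding p by (simp add: M_op_without_normal_cone[OF gd]) blast
  qed
  note cont = continuous_intros bounded_linear.continuous_on[OF matrix_vector_mul_bounded_linear]
  show ?thesis unfolding eq
    by (intro closed_Int closed_vimage closed_Collect_eq maximally_monotone_closed_graph maxi cont)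
qed

text \<open>
  A unilateral feasible deviation is a feasible profile, so the variational inequality applies to it and bounds
  the subgradient term of that player from below by 0.
\<close>
lemma GVI_imp_GNE:
  assumes gd: "game_data own \<Omega> A" and gvi: "GVI_solution own \<Omega> f A b x"
  shows "GNE own \<Omega> f A b x"
  unfolding GNE_def
proof
  fix i
  obtain l where x: "x \<in> shared_set own \<Omega> A b" and l: "l \<in> pseudo_subdiff own \<Omega> f x"
    and vi: "\<And>y. y \<in> shared_set own \<Omega> A b \<Longrightarrow> l \<bullet> (y - x) \<ge> 0"
    using gvi unfolding GVI_solution_def by blast
  have "f i x \<le> f i (deviate own i u x)" if "u \<in> feasible own \<Omega> A b i x" for u
  proof -
    have "f i x + l \<bullet> (deviate own i u x - x) \<le> f i (deviate own i u x)"
      using l that by (auto simp: pseudo_subdiff_iff feasible_def blk_inner_deviation)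
    moreover have "0 \<le> l \<bullet> (deviate own i u x - x)" using vi that by (simp add: feasible_def)
    ultimately show ?thesis by linarith
  qed
  moreover have "blk own i x \<in> feasible own \<Omega> A b i x"
    using x by (auto simp: feasible_def shared_set_def Omega_bar_def)
  ultimately show "is_arg_min (\<lambda>u. f i (deviate own i u x)) (\<lambda>u. u \<in> feasible own \<Omega> A b i x) (blk own i x)"
    by (auto simp: is_arg_min_def not_less)
qed

text \<open>
  The multiplier term is constant on the shared set, because there the coupling constraint is satisfied.
\<close>
lemma GVI_if_common_multiplier:
  assumes l: "- (transpose (Lam own A) *v kron_vec (\<chi> i. 1) \<eta>) \<in> pseudo_subdiff own \<Omega> f x"
    and feas: "(\<Sum>i\<in>UNIV. A i *v blk own i x) = (\<Sum>i\<in>UNIV. b i)"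
  shows "GVI_solution own \<Omega> f A b x"
proof -
  have "- (transpose (Lam own A) *v kron_vec (\<chi> i. 1) \<eta>) \<bullet> (y - x) \<ge> 0"
    if "y \<in> shared_set own \<Omega> A b" for y
  proof -
    have "(transpose (Lam own A) *v kron_vec (\<chi> i. 1) \<eta>) \<bullet> (y - x)
       = \<eta> \<bullet> ((\<Sum>i\<in>UNIV. A i *v blk own i y) - (\<Sum>i\<in>UNIV. A i *v blk own i x))"
      by (simp add: inner_matrix_transpose[symmetric] kron_one_inner part_Lam blk_diff
          matrix_vector_mult_diff_distrib sum_subtractf)
    then show ?thesis using that feas by (simp add: shared_set_def)
  qed
  moreover have "x \<in> shared_set own \<Omega> A b"
    using l feas by (simp add: shared_set_def pseudo_subdiff_iff)
  ultimately show ?thesis using l unfolding GVI_solution_def by blast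
qed

text \<open>
  The edge variables drop out after summation over the players, since the columns of the incidence matrix sum to 0.
\<close>
lemma zer_M_op_variational_GNE:
  assumes gd: "game_data own \<Omega> A" and loops: "\<And>l. src l \<noteq> tgt l" and conn: "connected_graph src tgt"
    and zero: "(x, Z, lam) \<in> zer (M_op own \<Omega> f A b src tgt)"
  shows "variational_GNE own \<Omega> f A b x" and "\<exists>l. lam = kron_vec (\<chi> i. 1) l"
proof -
  obtain g where g: "g \<in> pseudo_subdiff own \<Omega> f x" "0 = transpose (Lam own A) *v lam + g"
    and V: "0 = transpose (V_bar src tgt) *v lam"
    and bal: "0 = - (Lam own A *v x) - V_bar src tgt *v Z + col b"
  proof -
    have "(0, 0, 0) \<in> M_op own \<Omega> f A b src tgt (x, Z, lam)"
      using zero by (simp add: zer_def zero_prod_def)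
    then show ?thesis using that unfolding M_op_without_normal_cone[OF gd] by blast
  qed
  obtain l where l: "lam = kron_vec (\<chi> i. 1) l" using consensus_if_edges_agree[OF conn loops V[symmetric]] by blast
  then show "\<exists>l. lam = kron_vec (\<chi> i. 1) l" by blast
  \<comment> \<open>Tested against a consensus vector, the flow \<open>V Z\<close> vanishes.\<close>
  have "w \<bullet> (\<Sum>i\<in>UNIV. part i (V_bar src tgt *v Z)) = 0" for w
    unfolding kron_one_inner[symmetric] inner_matrix_transpose
    by (subst transpose_V_bar_kron_one) (use loops in auto)
  then have "(\<Sum>i\<in>UNIV. part i (V_bar src tgt *v Z)) = 0" by (metis inner_eq_zero_iff)
  moreover have "Lam own A *v x = col b - V_bar src tgt *v Z" using bal by (simp add: algebra_simps)
  then have "part i (Lam own A *v x) = b i - part i (V_bar src tgt *v Z)" for i by simp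
  ultimately have "(\<Sum>i\<in>UNIV. A i *v blk own i x) = (\<Sum>i\<in>UNIV. b i)"
    unfolding part_Lam by (simp add: sum_subtractf)
  moreover have "- (transpose (Lam own A) *v kron_vec (\<chi> i. 1) l) = g"
    using g(2)[symmetric] l by (simp only: add_eq_0_iff)
  ultimately have "GVI_solution own \<Omega> f A b x"
    using g(1) by (intro GVI_if_common_multiplier[where \<eta> = l]) simp_all
  then show "variational_GNE own \<Omega> f A b x" using GVI_imp_GNE[OF gd] by (simp add: variational_GNE_def)
qed

text \<open>
  This does the work of a Slater condition. Let \<open>\<phi>\<close> be the functional minus its value on the shared set; it
  is separable over the players and nonnegative. If \<open>w\<close> is a reaction of player \<open>i\<close> that balances the
  rivals of \<open>x\<close>, then \<open>\<phi>\<close> is 0 at \<open>w\<close> together with these rivals, and at least 0 at \<open>w\<close> together with any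
  others; hence the rivals of \<open>x\<close> minimize their part of \<open>\<phi>\<close>. As \<open>x\<close> was arbitrary, the rivals' part is
  constant. Doing this for two different players covers every coordinate.
\<close>
lemma functional_constant_if_everyone_can_balance:
  fixes own :: "'n::finite \<Rightarrow> 'p::finite" and A :: "'p \<Rightarrow> real ^ 'n ^ 'm"
  assumes gd: "game_data own \<Omega> A" and two: "i \<noteq> (j :: 'p)"
    and balance: "\<And>i x. x \<in> rivals own \<Omega> i \<Longrightarrow> feasible own \<Omega> A b i x \<noteq> {}"
    and nonneg: "\<And>x. x \<in> Omega_bar own \<Omega> \<Longrightarrow>
      v \<bullet> (\<Sum>i\<in>UNIV. b i) \<le> v \<bullet> (\<Sum>i\<in>UNIV. A i *v blk own i x)"
    and y: "y \<in> shared_set own \<Omega> A b" and x: "x \<in> Omega_bar own \<Omega>"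
  shows "v \<bullet> (\<Sum>i\<in>UNIV. A i *v blk own i x) = v \<bullet> (\<Sum>i\<in>UNIV. b i)"
proof -
  define \<phi> where "\<phi> x = v \<bullet> (\<Sum>i\<in>UNIV. A i *v blk own i x) - v \<bullet> (\<Sum>i\<in>UNIV. b i)" for x
  have \<phi>_nonneg: "0 \<le> \<phi> x" if "x \<in> Omega_bar own \<Omega>" for x using nonneg[OF that] by (simp add: \<phi>_def)
  have \<phi>_shared: "\<phi> x = 0" if "x \<in> shared_set own \<Omega> A b" for x
    using that by (simp add: shared_set_def \<phi>_def)
  have \<phi>_deviate: "\<phi> (deviate own i u x) = \<phi> x + v \<bullet> (A i *v blk own i (u - x))" for i u x
  proof -
    have "A j *v blk own j (deviate own i u x)
        = A j *v blk own j x + (if j = i then A i *v blk own i (u - x) else 0)" for j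
      by (auto simp: blk_deviate blk_deviate_other blk_diff matrix_vector_mult_diff_distrib)
    then show ?thesis by (simp add: \<phi>_def sum.distrib inner_add_right)
  qed
  have le: "\<phi> (deviate own i u x) \<le> \<phi> (deviate own i u y)"
    if xO: "x \<in> Omega_bar own \<Omega>" and yO: "y \<in> Omega_bar own \<Omega>" for i u x y
  proof -
    obtain w where w: "w \<in> \<Omega> i" "deviate own i w x \<in> shared_set own \<Omega> A b"
      using balance[OF Omega_bar_rivals[OF xO], of i] by (auto simp: feasible_def)
    have "\<phi> (deviate own i w x) \<le> \<phi> (deviate own i w y)"
      using \<phi>_shared[OF w(2)] \<phi>_nonneg Omega_bar_deviate[OF gd w(1) Omega_bar_rivals[OF yO]]
      by simp
    then show ?thesis
      by (simp add: \<phi>_deviate blk_diff matrix_vector_mult_diff_distrib inner_diff_right)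
  qed
  have same: "\<phi> (deviate own i u x) = \<phi> (deviate own i u y)"
    if "x \<in> Omega_bar own \<Omega>" "y \<in> Omega_bar own \<Omega>" for i u x y
    using le[OF that] le[OF that(2,1)] by (rule order_antisym)
  have y': "y \<in> Omega_bar own \<Omega>" using y by (simp add: shared_set_def)
  \<comment> \<open>A hybrid that agrees with \<open>x\<close> for player \<open>i\<close> and with \<open>y\<close> for all others, \<open>j\<close> among them: replacing first
    the rivals of \<open>i\<close> and then those of \<open>j\<close> leads from \<open>x\<close> to \<open>y\<close>.\<close>
  define z where "z = deviate own i (blk own i x) y"
  have z: "z \<in> Omega_bar own \<Omega>" unfolding z_def
    using x by (intro Omega_bar_deviate[OF gd _ Omega_bar_rivals[OF y']]) (simp add: Omega_bar_def)
  have zj: "deviate own j (blk own j y) z = z"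
    using two blk_deviate_other[of j i own "blk own i x" y] unfolding z_def by (metis deviate_blk)
  have "\<phi> x = \<phi> z" using same[OF x y', of i "blk own i x"] by (simp add: z_def)
  also have "\<dots> = \<phi> y" using same[OF z y', of j "blk own j y"] by (simp add: zj)
  finally show ?thesis using \<phi>_shared[OF y] by (simp add: \<phi>_def)
qed

text \<open>
  Lagrangian duality. The solution \<open>x\<close> minimizes \<open>l \<bullet> y\<close> over the shared set, so the convex set \<open>S\<close> of pairs
  (constraint violation of \<open>y\<close>, any number greater than \<open>l \<bullet> (y - x)\<close>) misses the origin. The
  quotient of the components \<open>v\<close> and \<open>t\<close> of a separating functional is the multiplier, provided that \<open>t\<close> is
  positive. The functional is chosen in the span of \<open>S\<close>: for \<open>t = 0\<close> it would vanish on \<open>S\<close>, hence be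
  orthogonal to itself.
\<close>
lemma GVI_common_multiplier:
  fixes own :: "'n::finite \<Rightarrow> 'p::finite" and A :: "'p \<Rightarrow> real ^ 'n ^ 'm::finite"
  assumes gd: "game_data own \<Omega> A" and two: "i \<noteq> (j :: 'p)"
    and balance: "\<And>i x. x \<in> rivals own \<Omega> i \<Longrightarrow> feasible own \<Omega> A b i x \<noteq> {}"
    and conv: "\<And>i. convex (\<Omega> i)"
    and gvi: "GVI_solution own \<Omega> f A b x"
  shows "\<exists>\<eta>. - (transpose (Lam own A) *v kron_vec (\<chi> i. 1) \<eta>) \<in> pseudo_subdiff own \<Omega> f x"
proof -
  define a where "a y = (\<Sum>i\<in>UNIV. A i *v blk own i y)" for y
  define \<beta> where "\<beta> = (\<Sum>i\<in>UNIV. b i)"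
  obtain l where xX: "x \<in> shared_set own \<Omega> A b" and l: "l \<in> pseudo_subdiff own \<Omega> f x"
    and vi: "\<And>y. y \<in> shared_set own \<Omega> A b \<Longrightarrow> l \<bullet> (y - x) \<ge> 0"
    using gvi unfolding GVI_solution_def by blast
  have x: "x \<in> Omega_bar own \<Omega>" and ax: "a x = \<beta>" using xX by (auto simp: shared_set_def a_def \<beta>_def)
  have a_add: "a (y + z) = a y + a z" and a_scale: "a (c *\<^sub>R y) = c *\<^sub>R a y" for y z c
    by (simp_all add: a_def blk_add blk_scaleR matrix_vector_right_distrib matrix_vector_mult_scaleR
        sum.distrib scaleR_sum_right)
  have convO: "convex (Omega_bar own \<Omega>)"
    using conv unfolding convex_def Omega_bar_def by (auto simp: blk_add blk_scaleR)
  define L where "L p = (a (fst p), l \<bullet> fst p + snd p)" for p :: "(real ^ 'n) \<times> real"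
  have linL: "linear L"
    by (intro linearI) (auto simp: L_def a_add a_scale inner_add_right algebra_simps)
  \<comment> \<open>Written as a translated linear image so that convexity is immediate.\<close>
  define S where "S = (+) (- \<beta>, - (l \<bullet> x)) ` L ` (Omega_bar own \<Omega> \<times> {0<..})"
  have S_mem: "(a y - \<beta>, l \<bullet> (y - x) + r) \<in> S" if "y \<in> Omega_bar own \<Omega>" "0 < r" for y r
    unfolding S_def
    by (rule image_eqI[of _ _ "L (y, r)"], simp add: L_def inner_diff_right)
      (use that in \<open>blast intro: imageI\<close>)
  have S_cases: "\<exists>y\<in>Omega_bar own \<Omega>. \<exists>r>0. p = (a y - \<beta>, l \<bullet> (y - x) + r)" if "p \<in> S" for p
    using that unfolding S_def L_def by (force simp: inner_diff_right)
  have "convex S" unfolding S_def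
    by (intro convex_translation convex_linear_image[OF linL] convex_Times convO) simp
  moreover have "S \<noteq> {}" using S_mem[OF x, of 1] by auto
  moreover have "0 \<notin> S"
  proof
    assume "0 \<in> S"
    then obtain y r where "y \<in> Omega_bar own \<Omega>" "r > 0" "a y = \<beta>" "l \<bullet> (y - x) + r = 0"
      using S_cases[of 0] by (auto simp: zero_prod_def)
    then show False using vi[of y] by (simp add: shared_set_def a_def \<beta>_def)
  qed
  ultimately obtain p where p: "p \<in> span S" "p \<noteq> 0" "\<And>s. s \<in> S \<Longrightarrow> 0 \<le> p \<bullet> s"
    using separating_hyperplane_set_0_inspan[of S] by blast
  obtain v t where vt: "p = (v, t)" by (cases p)
  have sep: "0 \<le> v \<bullet> (a y - \<beta>) + t * (l \<bullet> (y - x) + r)" if "y \<in> Omega_bar own \<Omega>" "0 < r" for y r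
    using p(3)[OF S_mem[OF that]] by (simp add: vt inner_Pair)
  have "0 \<le> t" using sep[OF x, of 1] ax by simp
  moreover have "t \<noteq> 0"
  proof
    assume t: "t = 0"
    have "v \<bullet> \<beta> \<le> v \<bullet> a y" if "y \<in> Omega_bar own \<Omega>" for y
      using sep[OF that, of 1] t by (simp add: inner_diff_right)
    then have "v \<bullet> a y = v \<bullet> \<beta>" if "y \<in> Omega_bar own \<Omega>" for y
      using functional_constant_if_everyone_can_balance[OF gd two balance _ xX that, of v]
      unfolding a_def \<beta>_def by blast
    then have "orthogonal p s" if "s \<in> S" for s
      using S_cases[OF that] by (auto simp: orthogonal_def vt t inner_Pair inner_diff_right)
    then have "orthogonal p p" using orthogonal_to_span p(1) by blast
    then show False using p(2) by (simp add: orthogonal_def)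
  qed
  ultimately have t: "0 < t" by simp
  define \<eta> where "\<eta> = v /\<^sub>R t"
  let ?q = "transpose (Lam own A) *v kron_vec (\<chi> i. 1) \<eta>"
  have "- (l + ?q) \<bullet> (y - x) \<le> 0" if y: "y \<in> Omega_bar own \<Omega>" for y
  proof -
    \<comment> \<open>The slack \<open>e / t\<close> in the second component of \<open>S\<close> contributes exactly \<open>e\<close>.\<close>
    have "0 \<le> (v \<bullet> (a y - \<beta>) + t * (l \<bullet> (y - x))) + e" if "0 < e" for e
      using sep[OF y, of "e / t"] t that by (simp add: distrib_left)
    then have "0 \<le> v \<bullet> (a y - \<beta>) + t * (l \<bullet> (y - x))" by (rule field_le_epsilon)
    then have "0 \<le> (v \<bullet> (a y - \<beta>) + t * (l \<bullet> (y - x))) / t" using t by simp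
    moreover have "?q \<bullet> (y - x) = \<eta> \<bullet> (a y - a x)"
      by (simp add: inner_matrix_transpose[symmetric] kron_one_inner part_Lam blk_diff a_def
          matrix_vector_mult_diff_distrib sum_subtractf)
    then have "?q \<bullet> (y - x) = v \<bullet> (a y - \<beta>) / t"
      by (simp add: \<eta>_def ax divide_inverse_commute)
    ultimately have "0 \<le> l \<bullet> (y - x) + ?q \<bullet> (y - x)" using t by (simp add: add_divide_distrib)
    then show ?thesis by (simp only: inner_minus_left inner_add_left)
  qed
  then have "- (l + ?q) \<in> normal_cone (Omega_bar own \<Omega>) x" using x by (simp add: normal_cone_def)
  from pseudo_subdiff_normal_cone[OF gd l this] show ?thesis by auto
qed

lemma zer_M_op_nonempty:
  fixes own :: "'n::finite \<Rightarrow> 'p::finite" and A :: "'p \<Rightarrow> real ^ 'n ^ 'm::finite"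
    and src tgt :: "'e::finite \<Rightarrow> 'p"
  assumes gd: "game_data own \<Omega> A" and loops: "\<And>l. src l \<noteq> tgt l" and conn: "connected_graph src tgt"
    and balance: "\<And>i x. x \<in> rivals own \<Omega> i \<Longrightarrow> feasible own \<Omega> A b i x \<noteq> {}"
    and conv: "\<And>i. convex (\<Omega> i)"
    and gvi: "GVI_solution own \<Omega> f A b x"
  shows "\<exists>Z lam. (x, Z, lam) \<in> zer (M_op own \<Omega> f A b src tgt)"
proof -
  obtain \<eta> where \<eta>: "- (transpose (Lam own A) *v kron_vec (\<chi> i. 1) \<eta>) \<in> pseudo_subdiff own \<Omega> f x"
    using GVI_common_multiplier[OF gd loops balance conv gvi] by blast
  have "(\<Sum>i\<in>UNIV. part i (col b - Lam own A *v x)) = 0"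
    using gvi by (simp add: GVI_solution_def shared_set_def part_Lam sum_subtractf)
  then obtain Z where "V_bar src tgt *v Z = col b - Lam own A *v x"
    using range_V_bar[OF conn loops] by blast
  moreover have "transpose (V_bar src tgt) *v kron_vec (\<chi> i. 1) \<eta> = 0"
    by (rule transpose_V_bar_kron_one[OF loops])
  ultimately have "(x, Z, kron_vec (\<chi> i. 1) \<eta>) \<in> zer (M_op own \<Omega> f A b src tgt)"
    unfolding zer_def M_op_without_normal_cone[OF gd] zero_prod_def mem_Collect_eq
    by (intro exI[of _ "- (transpose (Lam own A) *v kron_vec (\<chi> i. 1) \<eta>)"] conjI \<eta>) simp
  then show ?thesis by blast
qed

section \<open>The algorithm as a preconditioned proximal point iteration\<close>

lemma pos_def_nonneg: "pos_def G \<Longrightarrow> 0 \<le> v \<bullet> (G *v v)"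
  by (cases "v = 0") (auto simp: pos_def_on_def less_imp_le)

lemma pos_def_matrix_inv:
  fixes G :: "real ^ 'k ^ 'k"
  assumes "pos_def G"
  shows "G *v (matrix_inv G *v v) = v" and "matrix_inv G *v (G *v v) = v"
proof -
  have "\<forall>v. G *v v = 0 \<longrightarrow> v = 0" using assms unfolding pos_def_on_def by force
  then have "invertible G" by (simp add: invertible_left_inverse matrix_left_invertible_ker)
  then have "G ** matrix_inv G = mat 1 \<and> matrix_inv G ** G = mat 1"
    unfolding invertible_def matrix_inv_def by (rule someI_ex)
  then show "G *v (matrix_inv G *v v) = v" and "matrix_inv G *v (G *v v) = v"
    by (simp_all add: matrix_vector_mul_assoc)
qed

lemma symmetric_inner: "transpose G = G \<Longrightarrow> (G *v u) \<bullet> v = u \<bullet> (G *v v)"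
  for G :: "real ^ 'k ^ 'k"
  using inner_matrix_transpose[of u G v] by simp

text \<open>
  The block \<open>V\<^sup>T\<close> accounts for the extrapolation \<open>2 \<lambda>' - \<lambda>\<close> in the edge update, the block \<open>V\<close> for the
  old \<open>Z\<close> in the multiplier update, and the term \<open>L\<^sup>T H L\<close> for the players predicting the new
  multiplier from the old \<open>x\<close>.
\<close>
definition preconditioner ::
  "real ^ 'n ^ 'n \<Rightarrow> real ^ 'z ^ 'z \<Rightarrow> real ^ 'l ^ 'l \<Rightarrow> real ^ 'n ^ 'l \<Rightarrow> real ^ 'z ^ 'l
    \<Rightarrow> (real ^ 'n) \<times> (real ^ 'z) \<times> (real ^ 'l) \<Rightarrow> (real ^ 'n) \<times> (real ^ 'z) \<times> (real ^ 'l)" where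
  "preconditioner R W H L V = (\<lambda>(x, Z, lam).
     ((R - transpose L ** H ** L) *v x,
      matrix_inv W *v Z + transpose V *v lam,
      V *v Z + matrix_inv H *v lam))"

text \<open>
  With \<open>\<eta> = H\<^sup>-\<^sup>1 \<lambda>\<close>, completing the square splits the quadratic form of the coupled block into
  the form of \<open>W\<^sup>-\<^sup>1 - V\<^sup>T H V\<close> at \<open>Z\<close> and that of \<open>H\<close> at \<open>\<eta> + V Z\<close>.
\<close>
lemma weighted_norm_preconditioner:
  fixes R :: "real ^ 'n ^ 'n" and W :: "real ^ 'z ^ 'z" and H :: "real ^ 'l ^ 'l"
    and L :: "real ^ 'n ^ 'l" and V :: "real ^ 'z ^ 'l"
  assumes symR: "transpose R = R" and symH: "transpose H = H" and symW: "transpose W = W"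
    and H: "pos_def H" and W: "pos_def W"
    and RL: "pos_def (R - transpose L ** H ** L)"
    and WV: "pos_def (matrix_inv W - transpose V ** H ** V)"
  shows "weighted_norm (preconditioner R W H L V)"
proof (rule weighted_norm.intro)
  show "linear (preconditioner R W H L V)"
    by (intro linearI) (auto simp: preconditioner_def algebra_simps)
next
  fix w w' :: "(real ^ 'n) \<times> (real ^ 'z) \<times> (real ^ 'l)"
  obtain x Z lam where w: "w = (x, Z, lam)" by (cases w)
  obtain x' Z' lam' where w': "w' = (x', Z', lam')" by (cases w')
  have inv_sym: "(matrix_inv G *v u) \<bullet> v = u \<bullet> (matrix_inv G *v v)"
    if "transpose G = G" "pos_def G" for G :: "real ^ 'k ^ 'k" and u v
    using symmetric_inner[OF that(1), of "matrix_inv G *v u" "matrix_inv G *v v"]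
    by (simp add: pos_def_matrix_inv[OF that(2)])
  have "transpose (R - transpose L ** H ** L) = R - transpose L ** H ** L"
  proof -
    have "transpose (A - B) = transpose A - transpose B" for A B :: "real ^ 'n ^ 'n"
      by (simp add: transpose_def vec_eq_iff)
    then show ?thesis
      by (simp add: symR symH matrix_transpose_mul matrix_mul_assoc)
  qed
  moreover have "(transpose V *v lam) \<bullet> Z' = lam \<bullet> (V *v Z')" "(V *v Z) \<bullet> lam' = Z \<bullet> (transpose V *v lam')"
    using inner_matrix_transpose[of lam V Z'] inner_matrix_transpose[of Z "transpose V" lam'] by simp_all
  ultimately show "preconditioner R W H L V w \<bullet> w' = w \<bullet> preconditioner R W H L V w'"
    using inv_sym[OF symW W] inv_sym[OF symH H] symmetric_inner[of "R - transpose L ** H ** L"]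
    by (simp add: w w' preconditioner_def inner_Pair inner_add_left inner_add_right)
next
  fix w :: "(real ^ 'n) \<times> (real ^ 'z) \<times> (real ^ 'l)"
  assume nz: "w \<noteq> 0"
  obtain x Z lam where w: "w = (x, Z, lam)" by (cases w)
  define \<eta> where "\<eta> = matrix_inv H *v lam"
  have lam: "lam = H *v \<eta>" by (simp add: \<eta>_def pos_def_matrix_inv[OF H])
  have VHV: "Z \<bullet> ((matrix_inv W - transpose V ** H ** V) *v Z)
      = Z \<bullet> (matrix_inv W *v Z) - (V *v Z) \<bullet> (H *v (V *v Z))"
    using inner_matrix_transpose[of Z "transpose V" "H *v (V *v Z)"]
    by (simp add: matrix_vector_mult_diff_rdistrib inner_diff_right flip: matrix_vector_mul_assoc)
  have "Z \<bullet> (transpose V *v lam) = (V *v Z) \<bullet> lam" "lam \<bullet> (V *v Z) = (V *v Z) \<bullet> lam"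
    using inner_matrix_transpose[of Z "transpose V" lam] by (simp_all add: inner_commute)
  moreover have "(V *v Z) \<bullet> (H *v \<eta>) = \<eta> \<bullet> (H *v (V *v Z))"
    using symmetric_inner[OF symH, of \<eta> "V *v Z"] inner_commute[of "V *v Z" "H *v \<eta>"] by simp
  moreover have "lam \<bullet> (matrix_inv H *v lam) = \<eta> \<bullet> (H *v \<eta>)"
    by (simp add: lam pos_def_matrix_inv[OF H] inner_commute)
  ultimately have square: "w \<bullet> preconditioner R W H L V w
      = x \<bullet> ((R - transpose L ** H ** L) *v x)
        + Z \<bullet> ((matrix_inv W - transpose V ** H ** V) *v Z)
        + (\<eta> + V *v Z) \<bullet> (H *v (\<eta> + V *v Z))"
    unfolding VHV
    by (simp add: w preconditioner_def inner_add_left inner_add_right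
        matrix_vector_right_distrib flip: lam)
  note nonneg = pos_def_nonneg[OF RL, of x] pos_def_nonneg[OF WV, of Z]
    pos_def_nonneg[OF H, of "\<eta> + V *v Z"]
  consider "x \<noteq> 0" | "Z \<noteq> 0" | "Z = 0" "\<eta> \<noteq> 0"
    using nz by (cases "\<eta> = 0") (auto simp: w lam zero_prod_def)
  then show "0 < w \<bullet> preconditioner R W H L V w"
  proof cases
    case 1
    then have "0 < x \<bullet> ((R - transpose L ** H ** L) *v x)" using RL by (simp add: pos_def_on_def)
    then show ?thesis using nonneg square by linarith
  next
    case 2
    then have "0 < Z \<bullet> ((matrix_inv W - transpose V ** H ** V) *v Z)" using WV by (simp add: pos_def_on_def)
    then show ?thesis using nonneg square by linarith
  next
    case 3
    then have "0 < (\<eta> + V *v Z) \<bullet> (H *v (\<eta> + V *v Z))" using H by (simp add: pos_def_on_def)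
    then show ?thesis using nonneg square by linarith
  qed
qed

text \<open>
  The subtracted bracket in the first component is the gradient of the quadratic and linear terms that the
  subgame adds to the objectives; its negative is a pseudo-subgradient at \<open>x'\<close> by
  \<open>subgame_equilibrium_condition\<close>, which makes the right-hand side a value of \<open>M_op\<close>.
\<close>
lemma preconditioned_step:
  assumes H: "pos_def H" and W: "pos_def W"
    and lam': "lam' = lam + H *v (L *v x' + V *v Z - \<beta>)"
    and Z': "Z' = Z - W *v (transpose V *v (2 *\<^sub>R lam' - lam))"
  shows "preconditioner R W H L V ((x, Z, lam) - (x', Z', lam'))
    = (transpose L *v lam' + - (R *v (x' - x) + transpose L *v (lam + H *v (L *v x + V *v Z - \<beta>))),
       transpose V *v lam', - (L *v x') - V *v Z' + \<beta>)"
proof -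
  have "(R - transpose L ** H ** L) *v (x - x')
    = transpose L *v lam' + - (R *v (x' - x) + transpose L *v (lam + H *v (L *v x + V *v Z - \<beta>)))"
    unfolding lam' by (simp add: algebra_simps flip: matrix_vector_mul_assoc)
  moreover have "matrix_inv W *v (Z - Z') + transpose V *v (lam - lam') = transpose V *v lam'"
    unfolding Z' by (simp add: pos_def_matrix_inv[OF W] algebra_simps) (simp add: scaleR_2)
  moreover have "V *v (Z - Z') + matrix_inv H *v (lam - lam') = - (L *v x') - V *v Z' + \<beta>"
  proof -
    have "lam - lam' = H *v - (L *v x' + V *v Z - \<beta>)" by (simp add: lam' algebra_simps)
    then show ?thesis by (simp add: pos_def_matrix_inv[OF H] matrix_vector_mult_diff_distrib)
  qed
  ultimately show ?thesis by (simp add: preconditioner_def)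
qed

lemma is_arg_min_cong:
  "(\<And>u. S u \<Longrightarrow> g u = h u) \<Longrightarrow> is_arg_min g S x = is_arg_min h S x"
  by (auto simp: is_arg_min_def)

text \<open>
  Each player's best response is a proximal minimization, so its optimality condition is a partial
  subgradient; stacking these gives a pseudo-subgradient.
\<close>
lemma subgame_equilibrium_condition:
  assumes gd: "game_data own \<Omega> A" and a1: "assumption1 own \<Omega> f A b"
    and pad: "\<And>i. padded_square own i (R i)" and symR: "\<And>i. transpose (R i) = R i"
    and ne: "nash_equilibrium own \<Omega> (subgame_objective own f A b src tgt R H xk Zk lamk) xh"
  shows "- (diag_R own R *v (xh - xk) + transpose (Lam own A) *v
           (lamk + diag_blocks H *v (Lam own A *v xk + V_bar src tgt *v Zk - col b)))
         \<in> pseudo_subdiff own \<Omega> f xh"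
proof -
  let ?res = "Lam own A *v xk + V_bar src tgt *v Zk - col b"
  let ?g = "- (diag_R own R *v (xh - xk) + transpose (Lam own A) *v (lamk + diag_blocks H *v ?res))"
  have xh: "xh \<in> Omega_bar own \<Omega>"
    using ne by (auto simp: nash_equilibrium_def is_arg_min_def Omega_bar_def)
  have "blk own i ?g \<in> subdifferential (\<Omega> i) (\<lambda>u. f i (deviate own i u xh)) (blk own i xh)" for i
  proof -
    let ?p = "transpose (A i) *v part i (lamk + diag_blocks H *v ?res)"
    have obj: "subgame_objective own f A b src tgt R H xk Zk lamk i (deviate own i u xh)
        = f i (deviate own i u xh) + 1 / 2 * wnorm_sq (R i) (u - blk own i xk) + ?p \<bullet> u"
      if "u \<in> \<Omega> i" for u
    proof -
      have "u \<in> strategy_space own i" using gd that by (auto simp: game_data_def)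
      then have "blk own i (deviate own i u xh) = u" by (simp add: blk_deviate blk_strategy)
      then show ?thesis
        by (simp add: subgame_objective_def part_residual part_diag_blocks
            inner_matrix_transpose[symmetric])
    qed
    have "is_arg_min (\<lambda>u. subgame_objective own f A b src tgt R H xk Zk lamk i (deviate own i u xh))
        (\<lambda>u. u \<in> \<Omega> i) (blk own i xh)"
      using ne unfolding nash_equilibrium_def by blast
    then have min: "is_arg_min (\<lambda>u. f i (deviate own i u xh)
          + 1 / 2 * wnorm_sq (R i) (u - blk own i xk) + ?p \<bullet> u) (\<lambda>u. u \<in> \<Omega> i) (blk own i xh)"
      by (rule is_arg_min_cong[THEN iffD1, rotated]) (rule obj)
    have "convex_on (\<Omega> i) (\<lambda>u. f i (deviate own i u xh))"
      using a1 Omega_bar_rivals[OF xh, of i] unfolding assumption1_def proper_lsc_convex_def by blast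
    from subdifferential_if_prox_minimizer[OF this symR min]
    show ?thesis
      using gd by (simp only: blk_minus blk_add blk_diag_R[OF pad] blk_transpose_Lam game_data_def blk_diff)
  qed
  then show ?thesis by (simp add: pseudo_subdiff_def partial_subdiff_def)
qed

theorem theorem5:
  fixes own :: "'n::finite \<Rightarrow> 'p::finite"
    and \<Omega> :: "'p \<Rightarrow> (real ^ 'n) set"
    and f :: "'p \<Rightarrow> real ^ 'n \<Rightarrow> real"
    and A :: "'p \<Rightarrow> real ^ 'n ^ 'm::finite"
    and b :: "'p \<Rightarrow> real ^ 'm"
    and src tgt :: "'e::finite \<Rightarrow> 'p"
    and R :: "'p \<Rightarrow> real ^ 'n ^ 'n"
    and H :: "'p \<Rightarrow> real ^ 'm ^ 'm"
    and W :: "'e \<Rightarrow> real ^ 'm ^ 'm"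
    and \<rho> :: real
    and \<mu> :: "nat \<Rightarrow> real"
    and x :: "nat \<Rightarrow> real ^ 'n"
    and Z :: "nat \<Rightarrow> real ^ ('e \<times> 'm)"
    and lam :: "nat \<Rightarrow> real ^ ('p \<times> 'm)"
  assumes "game_data own \<Omega> A"
    and "assumption1 own \<Omega> f A b"
    and "assumption2 own \<Omega> f A b"
    and "simple_graph src tgt" and "connected_graph src tgt"
    and "1 \<le> \<rho>" and "\<rho> < 2"
    and "\<And>k. 0 \<le> \<mu> k" and "summable (\<lambda>k. \<mu> (Suc k))"
    and "\<And>i. padded_square own i (R i)"
    and "\<And>i. transpose (R i) = R i" and "\<And>i. pos_def_on (strategy_space own i) (R i)"
    and "\<And>i. transpose (H i) = H i" and "\<And>i. pos_def (H i)"
    and "\<And>l. transpose (W l) = W l" and "\<And>l. pos_def (W l)"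
    and "pos_def (diag_R own R - transpose (Lam own A) ** diag_blocks H ** Lam own A)"
    and "pos_def (matrix_inv (diag_blocks W)
           - transpose (V_bar src tgt) ** diag_blocks H ** V_bar src tgt)"
    and "algorithm1 own \<Omega> f A b src tgt R H W \<rho> \<mu> x Z lam"
  shows "\<exists>xs Zs lams.
           (\<lambda>k. (x k, Z k, lam k)) \<longlonglongrightarrow> (xs, Zs, lams) \<and>
           (xs, Zs, lams) \<in> zer (M_op own \<Omega> f A b src tgt) \<and>
           variational_GNE own \<Omega> f A b xs \<and>
           (\<exists>l. lams = kron_vec (\<chi> i. 1) l)"
proof -
  note gd = assms(1)
  have loops: "src l \<noteq> tgt l" for l using assms(4) by (simp add: simple_graph_def)
  have maxi: "maximally_monotone (pseudo_subdiff own \<Omega> f)" and conv: "\<And>i. convex (\<Omega> i)"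
    and "\<And>i x. x \<in> rivals own \<Omega> i \<Longrightarrow> rel_interior (feasible own \<Omega> A b i x) \<noteq> {}"
    using assms(2) by (simp_all add: assumption1_def)
  then have balance: "\<And>i x. x \<in> rivals own \<Omega> i \<Longrightarrow> feasible own \<Omega> A b i x \<noteq> {}"
    by fastforce
  obtain x0 where "GVI_solution own \<Omega> f A b x0" using assms(3) by (auto simp: assumption2_def)
  then obtain z0 where z0: "z0 \<in> zer (M_op own \<Omega> f A b src tgt)"
    using zer_M_op_nonempty[OF gd loops assms(5) balance conv] by blast

  define L where "L = Lam own A"
  define V :: "real ^ ('e \<times> 'm) ^ ('p \<times> 'm)" where "V = V_bar src tgt"
  define Hd where "Hd = diag_blocks H"
  define Wd where "Wd = diag_blocks W"
  define \<beta> where "\<beta> = col b"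
  have symH: "transpose Hd = Hd" and symW: "transpose Wd = Wd"
    unfolding Hd_def Wd_def using assms(13,15) by (simp_all add: transpose_diag_blocks)
  have H: "pos_def Hd" and W: "pos_def Wd"
    unfolding Hd_def Wd_def using assms(14,16) by (simp_all add: pos_def_diag_blocks)
  define P where "P = preconditioner (diag_R own R) Wd Hd L V"
  interpret weighted_norm P unfolding P_def
    by (rule weighted_norm_preconditioner[OF transpose_diag_R[OF assms(11)] symH symW H W])
      (use assms(17,18) in \<open>simp_all add: L_def V_def Hd_def Wd_def\<close>)

  obtain xh xt s where
    ne: "\<And>k. nash_equilibrium own \<Omega> (subgame_objective own f A b src tgt R H (x k) (Z k) (lam k)) (xh k)"
    and near: "\<And>k. norm (xt k - xh k) \<le> \<mu> k"
    and x_step: "\<And>k i. blk own i (x (Suc k))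
      = blk own i (x k) + \<rho> *\<^sub>R (blk own i (xt k) - blk own i (x k))"
    and lam_step: "\<And>k i. part i (lam (Suc k))
      = part i (lam k) + \<rho> *\<^sub>R (H i *v residual own A b src tgt i (xt k) (Z k))"
    and s_eq: "\<And>k i. s k i = (1 / \<rho>) *\<^sub>R part i (lam (Suc k)) + ((\<rho> - 1) / \<rho>) *\<^sub>R part i (lam k)
      + H i *v residual own A b src tgt i (xt k) (Z k)"
    and Z_step: "\<And>k l. part l (Z (Suc k))
      = part l (Z k) - \<rho> *\<^sub>R (W l *v (s k (tgt l) - s k (src l)))"
    using assms(19) unfolding algorithm1_def by blast

  \<comment> \<open>The unrelaxed increment of the multipliers if the players use the profile \<open>y\<close>;
    \<open>s = \<lambda> + 2 r\<close> equals \<open>2 \<lambda>' - \<lambda>\<close>.\<close>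
  define r where "r k y = Hd *v (L *v y + V *v Z k - \<beta>)" for k y
  have part_r: "H i *v residual own A b src tgt i (xt k) (Z k) = part i (r k (xt k))" for i k
    by (simp add: r_def Hd_def part_diag_blocks L_def V_def \<beta>_def part_residual)
  have x_Suc: "x (Suc k) = x k + \<rho> *\<^sub>R (xt k - x k)" for k
    by (rule blk_eqI[where own = own]) (simp add: x_step blk_add blk_scaleR blk_diff)
  have lam_Suc: "lam (Suc k) = lam k + \<rho> *\<^sub>R r k (xt k)" for k
    by (intro part_eqI) (simp add: lam_step part_r)
  have s_part: "s k i = part i (lam k + 2 *\<^sub>R r k (xt k))" for k i
  proof -
    have "(1 / \<rho>) *\<^sub>R (p + \<rho> *\<^sub>R q) + ((\<rho> - 1) / \<rho>) *\<^sub>R p + q = p + 2 *\<^sub>R q" for p q :: "real ^ 'm"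
    proof -
      have "(1 / \<rho>) *\<^sub>R (p + \<rho> *\<^sub>R q) + ((\<rho> - 1) / \<rho>) *\<^sub>R p + q
          = (1 / \<rho> + (\<rho> - 1) / \<rho>) *\<^sub>R p + (1 / \<rho> * \<rho> + 1) *\<^sub>R q"
        by (simp only: scaleR_add_right scaleR_add_left scaleR_scaleR scaleR_one ac_simps)
      also have "1 / \<rho> + (\<rho> - 1) / \<rho> = 1" using \<open>1 \<le> \<rho>\<close> by (simp add: field_simps)
      also have "1 / \<rho> * \<rho> + 1 = 2" using \<open>1 \<le> \<rho>\<close> by simp
      finally show ?thesis by simp
    qed
    then show ?thesis by (simp only: s_eq part_r lam_Suc part_add part_scaleR)
  qed
  have Z_Suc: "Z (Suc k) = Z k - \<rho> *\<^sub>R (Wd *v (transpose V *v (lam k + 2 *\<^sub>R r k (xt k))))" for k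
    by (intro part_eqI)
      (simp only: part_diff part_scaleR Wd_def part_diag_blocks V_def part_transpose_V_bar[of src _ tgt, OF loops]
        Z_step s_part)

  \<comment> \<open>The unrelaxed round as a function of the subgame profile: exact at \<open>xh k\<close>, performed at \<open>xt k\<close>.\<close>
  define step where "step k y = (y, Z k - Wd *v (transpose V *v (lam k + 2 *\<^sub>R r k y)), lam k + r k y)" for k y
  define v where "v k = step k (xh k)" for k
  define w where "w k = (x k, Z k, lam k)" for k
  have prox: "P (w k - v k) \<in> M_op own \<Omega> f A b src tgt (v k)" for k
  proof -
    let ?g = "- (diag_R own R *v (xh k - x k) + transpose L *v (lam k + Hd *v (L *v x k + V *v Z k - \<beta>)))"
    let ?lam = "lam k + r k (xh k)"
    let ?Z = "Z k - Wd *v (transpose V *v (lam k + 2 *\<^sub>R r k (xh k)))"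
    have "2 *\<^sub>R ?lam - lam k = lam k + 2 *\<^sub>R r k (xh k)" by (simp add: scaleR_2)
    then have "P (w k - v k) = (transpose L *v ?lam + ?g, transpose V *v ?lam, - (L *v xh k) - V *v ?Z + \<beta>)"
      unfolding P_def w_def v_def step_def by (intro preconditioned_step H W) (simp_all add: r_def)
    moreover have "?g \<in> pseudo_subdiff own \<Omega> f (xh k)"
      unfolding L_def V_def Hd_def \<beta>_def
      by (rule subgame_equilibrium_condition[OF gd assms(2,10,11) ne])
    ultimately show ?thesis
      unfolding v_def step_def M_op_without_normal_cone[OF gd] L_def V_def \<beta>_def by blast
  qed

  \<comment> \<open>The round is affine in the subgame profile, with this linear part.\<close>
  define E where "E d = (d, - (2 *\<^sub>R (Wd *v (transpose V *v (Hd *v (L *v d))))), Hd *v (L *v d))" for d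
  have E: "linear E" by (intro linearI) (auto simp: E_def algebra_simps)
  obtain B where B: "0 < B" "\<And>d. norm (E d) \<le> B * norm d" using linear_bounded_pos[OF E] by blast
  have err: "norm (w (Suc k) - (w k + \<rho> *\<^sub>R (v k - w k))) \<le> \<rho> * B * \<mu> k" for k
  proof -
    have r_diff: "r k (xt k) = r k (xh k) + Hd *v (L *v (xt k - xh k))"
      by (simp add: r_def algebra_simps)
    have "w (Suc k) = w k + \<rho> *\<^sub>R (step k (xt k) - w k)"
      by (simp add: w_def step_def x_Suc Z_Suc lam_Suc algebra_simps)
    moreover have "step k (xt k) - v k = E (xt k - xh k)"
      unfolding step_def v_def E_def r_diff
      by (simp add: matrix_vector_right_distrib matrix_vector_mult_scaleR scaleR_add_right)
    moreover have "w k + \<rho> *\<^sub>R (p - w k) - (w k + \<rho> *\<^sub>R (v k - w k)) = \<rho> *\<^sub>R (p - v k)" for p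
      by (simp add: algebra_simps)
    ultimately have "w (Suc k) - (w k + \<rho> *\<^sub>R (v k - w k)) = \<rho> *\<^sub>R E (xt k - xh k)"
      by simp
    then have "norm (w (Suc k) - (w k + \<rho> *\<^sub>R (v k - w k))) = \<rho> * norm (E (xt k - xh k))"
      using \<open>1 \<le> \<rho>\<close> by simp
    also have "\<dots> \<le> \<rho> * (B * \<mu> k)"
      using \<open>1 \<le> \<rho>\<close> B(2)[of "xt k - xh k"] mult_left_mono[OF near[of k], of B] B(1)
      by (intro mult_left_mono) linarith+
    finally show ?thesis by (simp add: mult.assoc)
  qed
  have "summable (\<lambda>k. \<rho> * B * \<mu> k)"
    using assms(9) by (intro summable_mult) (simp add: summable_Suc_iff)
  moreover have "monotone_operator (M_op own \<Omega> f A b src tgt)"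
    using maxi by (intro monotone_M_op[OF gd]) (simp add: maximally_monotone_def)
  moreover have "closed {(w, u). u \<in> M_op own \<Omega> f A b src tgt w}"
    by (rule closed_graph_M_op[OF gd maxi])
  moreover have "0 < \<rho>" using \<open>1 \<le> \<rho>\<close> by simp
  ultimately have "\<exists>z\<in>zer (M_op own \<Omega> f A b src tgt). w \<longlonglongrightarrow> z"
    using z0 \<open>\<rho> < 2\<close> prox err by (intro inexact_relaxed_proximal_point)
  then obtain z where z: "z \<in> zer (M_op own \<Omega> f A b src tgt)" "w \<longlonglongrightarrow> z" ..
  obtain xs Zs lams where "z = (xs, Zs, lams)" by (cases z)
  then show ?thesis
    using z zer_M_op_variational_GNE[OF gd loops assms(5), of xs Zs lams f b]
    unfolding w_def[abs_def] by blast
qed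

end
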